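(* Let $\Sigma_{[\mathrm{O}(2)]}\subset\mathbb{E}\mathrm{la}$ be the transversely isotropic stratum. For $\mathbf{E}=(\operatorname{tr}\mathbf{d},\operatorname{tr}\mathbf{v},\mathbf{d}',\mathbf{v}',\mathbf{H})\in\Sigma_{[\mathrm{O}(2)]}$ set $$\mathbf{t}:=2\,\frac{\left(\|\mathbf{d}'\|^2\,\mathbf{d}'^2+\|\mathbf{v}'\|^2\,\mathbf{v}'^2+\mathbf{d}_2'^2\right)'}{\|\mathbf{d}'\|^4+\|\mathbf{v}'\|^4+\|\mathbf{d}_2'\|^2}\in\mathbb{H}^2(\mathbb{R}^3).$$ A minimal functional basis for $\Sigma_{[\mathrm{O}(2)]}$ (under the action of $\mathrm{SO}(3)$) consists of the five rational invariants $$\kappa_1:=\operatorname{tr}\mathbf{d},\quad \kappa_2:=\operatorname{tr}\mathbf{v},\quad \kappa_3:=\mathbf{d}:\mathbf{t},\quad \kappa_4:=\mathbf{v}:\mathbf{t},\quad \kappa_5:=\mathbf{t}:\mathbf{H}:\mathbf{t}.$$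
   Context: Tensors are on Euclidean $\mathbb{R}^3$, with components in an orthonormal basis $(e_i)$ and summation over repeated indices; $\mathbf{q}=(\delta_{ij})$ is the Euclidean metric. $\mathrm{SO}(3)$ acts on $n$th-order tensors by $(g\star \mathbf{T})_{i_1\dots i_n}=g_{i_1j_1}\cdots g_{i_nj_n}T_{j_1\dots j_n}$. $\mathbb{E}\mathrm{la}=\{\mathbf{E}\in\otimes^4(\mathbb{R}^3):E_{ijkl}=E_{klij}=E_{jikl}\}$ is the 21-dimensional space of elasticity tensors. $\mathbf{T}^s$ denotes the total symmetrization and $\mathbf{S}_1\odot\mathbf{S}_2:=(\mathbf{S}_1\otimes\mathbf{S}_2)^s$. For symmetric second-order tensors: $\mathbf{a}'=\mathbf{a}-\frac13(\operatorname{tr}\mathbf{a})\mathbf{q}$ (deviatoric part), $\mathbf{a}'^2=(\mathbf{a}')^2$ is the matrix square, $\mathbf{a}:\mathbf{b}=a_{ij}b_{ij}$, $\|\mathbf{a}\|^2=\mathbf{a}:\mathbf{a}$, and $\mathbf{a}:\mathbf{H}:\mathbf{b}=a_{ij}H_{ijkl}b_{kl}$. $\mathbb{H}^2(\mathbb{R}^3)$ is the space of traceless symmetric second-order tensors. Harmonic decomposition: for $\mathbf{E}\in\mathbb{E}\mathrm{la}$, $d_{ij}=E_{kkij}$, $v_{ij}=E_{kikj}$, $\mathbf{a}=\frac27(\mathbf{d}+2\mathbf{v})$ and $\mathbf{H}=\mathbf{E}^s-\mathbf{q}\odot\mathbf{a}'-\frac{7}{30}(\operatorname{tr}\mathbf{a})\,\mathbf{q}\odot\mathbf{q}$,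 which is a totally symmetric traceless fourth-order tensor. The tensor $\mathbf{E}$ is identified with the tuple $(\operatorname{tr}\mathbf{d},\operatorname{tr}\mathbf{v},\mathbf{d}',\mathbf{v}',\mathbf{H})$ (an $\mathrm{SO}(3)$-equivariant linear isomorphism). Also $(\mathbf{d}_2)_{ij}=H_{ipqr}H_{pqrj}$. For every transversely isotropic $\mathbf{E}$ one has $\|\mathbf{d}'\|^4+\|\mathbf{v}'\|^4+\|\mathbf{d}_2'\|^2\neq0$, so that $\mathbf{t}$ is well defined. Stratum: for a subgroup $K$ of $\mathrm{SO}(3)$, $\Sigma_{[K]}$ is the set of tensors whose symmetry group $\{g\in\mathrm{SO}(3):g\star\mathbf{E}=\mathbf{E}\}$ is conjugate to $K$ in $\mathrm{SO}(3)$. Here $\mathrm{O}(2)$ is the subgroup of $\mathrm{SO}(3)$ generated by all rotations about $e_3$ and the rotation by $\pi$ about $e_1$. A tensor is transversely isotropic if it belongs to $\Sigma_{[\mathrm{O}(2)]}$. Functional basis: a finite set $\{\varphi_1,\dots,\varphi_s\}$ of $\mathrm{SO}(3)$-invariant real functions on an $\mathrm{SO}(3)$-stable set $X$ is a functional basis for $X$ if for every $\mathrm{SO}(3)$-invariant function $f:X\to\mathbb{R}$ there is a function $F:\mathbb{R}^s\to\mathbb{R}$ (no regularity required) with $f(x)=F(\varphi_1(x),\dots,\varphi_s(x))$ for all $x\in X$. It is minimal if no proper subset of it is a functional basis for $X$. *)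

theory Defs
  imports "HOL-Analysis.Analysis" "HOL-Algebra.Generated_Groups" "HOL-Algebra.Group_Action"
begin

text \<open>Tensors are given by their components in the standard orthonormal basis.  On second-order
  tensors the library inner product is \<open>a : b\<close>, so \<open>norm\<close> is the Frobenius norm; the
  metric \<open>q\<close> is \<open>mat 1\<close> and the matrix square of \<open>a\<close> is \<open>a ** a\<close>.\<close>

type_synonym tensor2 = "real^3^3"
type_synonym tensor4 = "real^3^3^3^3"

definition dev :: "tensor2 \<Rightarrow> tensor2" where
  "dev a = a - (1/3 * trace a) *\<^sub>R mat 1"

definition harmonic2 :: "tensor2 set" where
  "harmonic2 = {a. transpose a = a \<and> trace a = 0}"

definition tensor_prod :: "tensor2 \<Rightarrow> tensor2 \<Rightarrow> tensor4" where
  "tensor_prod a b = (\<chi> i j k l. a$i$j * b$k$l)"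

definition tsym :: "tensor4 \<Rightarrow> tensor4" where
  "tsym T = (\<chi> i j k l. (1 / fact 4) *
     (\<Sum>\<sigma> | \<sigma> permutes {..<4::nat}.
        let p = (\<lambda>n. [i, j, k, l] ! \<sigma> n) in T $ p 0 $ p 1 $ p 2 $ p 3))"

definition sym_prod :: "tensor2 \<Rightarrow> tensor2 \<Rightarrow> tensor4" where
  "sym_prod a b = tsym (tensor_prod a b)"

definition contract :: "tensor2 \<Rightarrow> tensor4 \<Rightarrow> tensor2 \<Rightarrow> real" where
  "contract a H b = (\<Sum>i\<in>UNIV. \<Sum>j\<in>UNIV. \<Sum>k\<in>UNIV. \<Sum>l\<in>UNIV. a$i$j * H$i$j$k$l * b$k$l)"

definition SO3 :: "tensor2 monoid" where
  "SO3 = \<lparr>carrier = {g. rotation_matrix g}, monoid.mult = (**), one = mat 1\<rparr>"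

definition act4 :: "tensor2 \<Rightarrow> tensor4 \<Rightarrow> tensor4" where
  "act4 g T = (\<chi> i j k l. \<Sum>p\<in>UNIV. \<Sum>q\<in>UNIV. \<Sum>r\<in>UNIV. \<Sum>s\<in>UNIV.
     g$i$p * g$j$q * g$k$r * g$l$s * T$p$q$r$s)"

definition rot_e3 :: "real \<Rightarrow> tensor2" where
  "rot_e3 \<theta> = vector [vector [cos \<theta>, - sin \<theta>, 0], vector [sin \<theta>, cos \<theta>, 0], vector [0, 0, 1]]"

definition rot_e1_pi :: tensor2 where
  "rot_e1_pi = vector [vector [1, 0, 0], vector [0, -1, 0], vector [0, 0, -1]]"

definition O2 :: "tensor2 set" where
  "O2 = generate SO3 (insert rot_e1_pi (range rot_e3))"

definition Ela :: "tensor4 set" where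
  "Ela = {E. \<forall>i j k l. E$i$j$k$l = E$k$l$i$j \<and> E$i$j$k$l = E$j$i$k$l}"

text \<open>The coset expression is the conjugate subgroup \<open>g K g\<^sup>-\<^sup>1\<close>.\<close>

definition stratum :: "tensor2 set \<Rightarrow> tensor4 set" where
  "stratum K = {E \<in> Ela. \<exists>g \<in> carrier SO3.
     stabilizer SO3 act4 E = (g <#\<^bsub>SO3\<^esub> K) #>\<^bsub>SO3\<^esub> inv\<^bsub>SO3\<^esub> g}"

definition invariant_on ::
  "('g, 'b) monoid_scheme \<Rightarrow> ('g \<Rightarrow> 'a \<Rightarrow> 'a) \<Rightarrow> 'a set \<Rightarrow> ('a \<Rightarrow> real) \<Rightarrow> bool" where
  "invariant_on G act X f \<longleftrightarrow> (\<forall>g \<in> carrier G. \<forall>x \<in> X. f (act g x) = f x)"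

text \<open>The members of \<open>\<Phi>\<close> are functions on \<open>X\<close>, hence required to be extensional
  (\<open>undefined\<close> outside \<open>X\<close>): functions agreeing on \<open>X\<close> are then equal, as minimality
  requires.  The coordinates of \<open>\<real>\<^sup>s\<close>, where \<open>s = card \<Phi>\<close>, are indexed by the
  members of \<open>\<Phi>\<close> themselves: the argument of \<open>F\<close> is the tuple of the values
  of all \<open>\<phi> \<in> \<Phi>\<close> at \<open>x\<close>.\<close>

definition functional_basis ::
  "('g, 'b) monoid_scheme \<Rightarrow> ('g \<Rightarrow> 'a \<Rightarrow> 'a) \<Rightarrow> 'a set \<Rightarrow> ('a \<Rightarrow> real) set \<Rightarrow> bool" where
  "functional_basis G act X \<Phi> \<longleftrightarrow>
     (\<forall>g \<in> carrier G. \<forall>x \<in> X. act g x \<in> X) \<and>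
     finite \<Phi> \<and> \<Phi> \<subseteq> extensional X \<and> (\<forall>\<phi> \<in> \<Phi>. invariant_on G act X \<phi>) \<and>
     (\<forall>f. invariant_on G act X f \<longrightarrow>
        (\<exists>F :: (('a \<Rightarrow> real) \<Rightarrow> real) \<Rightarrow> real. \<forall>x \<in> X. f x = F (\<lambda>\<phi>\<in>\<Phi>. \<phi> x)))"

definition minimal_functional_basis ::
  "('g, 'b) monoid_scheme \<Rightarrow> ('g \<Rightarrow> 'a \<Rightarrow> 'a) \<Rightarrow> 'a set \<Rightarrow> ('a \<Rightarrow> real) set \<Rightarrow> bool" where
  "minimal_functional_basis G act X \<Phi> \<longleftrightarrow>
     functional_basis G act X \<Phi> \<and> (\<forall>\<Psi>. \<Psi> \<subset> \<Phi> \<longrightarrow> \<not> functional_basis G act X \<Psi>)"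

definition rational_on :: "'a::real_normed_vector set \<Rightarrow> ('a \<Rightarrow> real) \<Rightarrow> bool" where
  "rational_on X f \<longleftrightarrow> (\<exists>p q. real_polynomial_function p \<and> real_polynomial_function q \<and>
     (\<forall>x \<in> X. q x \<noteq> 0 \<and> f x = p x / q x))"

definition d_tens :: "tensor4 \<Rightarrow> tensor2" where
  "d_tens E = (\<chi> i j. \<Sum>k\<in>UNIV. E$k$k$i$j)"

definition v_tens :: "tensor4 \<Rightarrow> tensor2" where
  "v_tens E = (\<chi> i j. \<Sum>k\<in>UNIV. E$k$i$k$j)"

definition a_tens :: "tensor4 \<Rightarrow> tensor2" where
  "a_tens E = (2/7) *\<^sub>R (d_tens E + 2 *\<^sub>R v_tens E)"

definition H_tens :: "tensor4 \<Rightarrow> tensor4" where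
  "H_tens E = tsym E - sym_prod (mat 1) (dev (a_tens E))
     - (7/30 * trace (a_tens E)) *\<^sub>R sym_prod (mat 1) (mat 1)"

definition d2_tens :: "tensor4 \<Rightarrow> tensor2" where
  "d2_tens E = (\<chi> i j. \<Sum>p\<in>UNIV. \<Sum>q\<in>UNIV. \<Sum>r\<in>UNIV. H_tens E $i$p$q$r * H_tens E $p$q$r$j)"

text \<open>The denominator below does not vanish on the transversely isotropic stratum, so
  division by zero does not occur there.\<close>

definition t_tens :: "tensor4 \<Rightarrow> tensor2" where
  "t_tens E =
     (let d' = dev (d_tens E); v' = dev (v_tens E); d2' = dev (d2_tens E) in
      (2 / (norm d' ^ 4 + norm v' ^ 4 + (norm d2')\<^sup>2)) *\<^sub>R
        dev ((norm d')\<^sup>2 *\<^sub>R (d' ** d') + (norm v')\<^sup>2 *\<^sub>R (v' ** v') + d2' ** d2'))"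

definition \<kappa>\<^sub>1 :: "tensor4 \<Rightarrow> real" where "\<kappa>\<^sub>1 E = trace (d_tens E)"
definition \<kappa>\<^sub>2 :: "tensor4 \<Rightarrow> real" where "\<kappa>\<^sub>2 E = trace (v_tens E)"
definition \<kappa>\<^sub>3 :: "tensor4 \<Rightarrow> real" where "\<kappa>\<^sub>3 E = d_tens E \<bullet> t_tens E"
definition \<kappa>\<^sub>4 :: "tensor4 \<Rightarrow> real" where "\<kappa>\<^sub>4 E = v_tens E \<bullet> t_tens E"
definition \<kappa>\<^sub>5 :: "tensor4 \<Rightarrow> real" where "\<kappa>\<^sub>5 E = contract (t_tens E) (H_tens E) (t_tens E)"

end

theory Submission
  imports Defs
begin

text \<open>\<open>O2\<close> is the group of rotations that preserve the line spanned by \<open>e3\<close> (lemma \<open>O2_eq\<close>), and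
  its conjugates are the corresponding groups for the other lines.  An elasticity tensor fixed by
  \<open>O2\<close> is a combination \<open>ti_tensor c1 c2 c3 c4 c5 e3\<close> of five tensors built from the metric and
  \<open>e3 \<otimes> e3\<close> (lemma \<open>O2_fixed_normal_form\<close>).  A rotation acts on such combinations by moving their
  axis (lemma \<open>act4_ti_tensor\<close>), so every transversely isotropic tensor is of the form
  \<open>ti_tensor c1 c2 c3 c4 c5 n\<close> with a unit vector \<open>n\<close>.

  Let \<open>B\<close> be the deviator of \<open>n \<otimes> n\<close>.  Direct contraction shows that the deviators of \<open>d\<close>, \<open>v\<close> and
  \<open>d2\<close> are multiples \<open>x B\<close>, \<open>y B\<close> and \<open>(4/49) h\<^sup>2 B\<close>, and that \<open>H\<close> is \<open>h\<close> times the harmonic part of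
  \<open>n \<otimes> n \<otimes> n \<otimes> n\<close>.  The numbers \<open>tr d\<close>, \<open>tr v\<close>, \<open>x\<close>, \<open>y\<close>, \<open>h\<close> depend linearly and bijectively
  on the coefficients \<open>c1\<close>, ..., \<open>c5\<close>.

  Since \<open>(norm B)\<^sup>2 = 2/3\<close> and the deviator of \<open>B ** B\<close> is \<open>B/3\<close>, the weights in the definition of
  \<open>t\<close> are such that \<open>t = B\<close> whenever \<open>(x, y, h) \<noteq> 0\<close> (lemma \<open>t_ti_tensor\<close>).  Then \<open>t\<close> determines
  \<open>n\<close> up to sign, so the stabilizer is exactly the conjugate of \<open>O2\<close> with axis \<open>n\<close>; if
  \<open>(x, y, h) = 0\<close>, the tensor is isotropic.  Hence the stratum consists of the tensors
  \<open>ti_tensor c1 c2 c3 c4 c5 n\<close> with \<open>n\<close> a unit vector and \<open>(x, y, h) \<noteq> 0\<close> (lemma \<open>stratum_O2\<close>).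

  On the stratum the five invariants are \<open>tr d\<close>, \<open>tr v\<close>, \<open>(2/3) x\<close>, \<open>(2/3) y\<close> and \<open>(8/35) h\<close> (lemma
  \<open>kappa_ti_tensor\<close>).  They determine the coefficients, and rotations move any axis to any other,
  so they separate orbits.  They take all values with the last three not all zero (lemma
  \<open>kappa_attains\<close>), so each of them can be varied while the other four stay fixed, which gives
  minimality.\<close>

section \<open>Total symmetrization and the Kronecker tensor\<close>

lemma sum_permutes_4:
  fixes f :: "nat \<Rightarrow> nat \<Rightarrow> nat \<Rightarrow> nat \<Rightarrow> real"
  shows "(\<Sum>\<sigma> | \<sigma> permutes {..<4}. f (\<sigma> 0) (\<sigma> 1) (\<sigma> 2) (\<sigma> 3)) =
     f 0 1 2 3 + f 0 1 3 2 + f 0 2 1 3 + f 0 2 3 1 + f 0 3 1 2 + f 0 3 2 1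
   + f 1 0 2 3 + f 1 0 3 2 + f 1 2 0 3 + f 1 2 3 0 + f 1 3 0 2 + f 1 3 2 0
   + f 2 0 1 3 + f 2 0 3 1 + f 2 1 0 3 + f 2 1 3 0 + f 2 3 0 1 + f 2 3 1 0
   + f 3 0 1 2 + f 3 0 2 1 + f 3 1 0 2 + f 3 1 2 0 + f 3 2 0 1 + f 3 2 1 0"
proof -
  have set4: "{..<4::nat} = insert 0 (insert 1 (insert 2 (insert 3 {})))" by auto
  show ?thesis
    unfolding set4
    by (simp add: sum_over_permutations_insert Transposition.transpose_def del: One_nat_def)
qed

lemma tsym_nth:
  "tsym T $ i $ j $ k $ l = (1/24) * (
     T$i$j$k$l + T$i$j$l$k + T$i$k$j$l + T$i$k$l$j + T$i$l$j$k + T$i$l$k$j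
   + T$j$i$k$l + T$j$i$l$k + T$j$k$i$l + T$j$k$l$i + T$j$l$i$k + T$j$l$k$i
   + T$k$i$j$l + T$k$i$l$j + T$k$j$i$l + T$k$j$l$i + T$k$l$i$j + T$k$l$j$i
   + T$l$i$j$k + T$l$i$k$j + T$l$j$i$k + T$l$j$k$i + T$l$k$i$j + T$l$k$j$i)"
  unfolding tsym_def Let_def
  by (simp add: sum_permutes_4[of "\<lambda>a b c d. T $ ([i,j,k,l]!a) $ ([i,j,k,l]!b) $ ([i,j,k,l]!c) $ ([i,j,k,l]!d)", simplified]
      fact_numeral)

lemma kron_contract: "(\<Sum>k\<in>UNIV. (mat 1 :: real^'n^'n) $ i $ k * f k) = f i"
  by (simp add: mat_def if_distrib[of "\<lambda>x. x * _"] cong: if_cong)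

lemma kron_commute: "(mat 1 :: real^'n^'n) $ i $ j = mat 1 $ j $ i"
  by (simp add: mat_def)

lemma kron_components: "(mat 1 :: tensor2)$1$1 = 1" "(mat 1 :: tensor2)$2$2 = 1" "(mat 1 :: tensor2)$3$3 = 1"
 "(mat 1 :: tensor2)$1$2 = 0" "(mat 1 :: tensor2)$1$3 = 0" "(mat 1 :: tensor2)$2$1 = 0"
 "(mat 1 :: tensor2)$2$3 = 0" "(mat 1 :: tensor2)$3$1 = 0" "(mat 1 :: tensor2)$3$2 = 0"
  by (auto simp: mat_def)

lemma unit_vector_components:
  fixes n :: "real^3" assumes "norm n = 1"
  shows "n$1 * n$1 + n$2 * n$2 + n$3 * n$3 = 1"
  using assms by (simp add: norm_eq_1 inner_vec_def sum_3)

lemma kron_contract_vector: "(mat 1 :: tensor2) $ i $ 1 * n $ 1 + (mat 1 :: tensor2) $ i $ 2 * n $ 2 + (mat 1 :: tensor2) $ i $ 3 * n $ 3 = n $ i"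
  using kron_contract[of i "\<lambda>k. n $ k"] by (simp add: sum_3)

lemma kron_contract_kron: "(mat 1 :: tensor2) $ i $ 1 * mat 1 $ j $ 1 + (mat 1 :: tensor2) $ i $ 2 * mat 1 $ j $ 2 + (mat 1 :: tensor2) $ i $ 3 * mat 1 $ j $ 3 = mat 1 $ i $ j"
  using kron_contract[of i "\<lambda>k. mat 1 $ j $ k"] by (simp add: sum_3 kron_commute)

section \<open>The action on fourth-order tensors\<close>

lemma act4_nth: "act4 g T $ i $ j $ k $ l = (\<Sum>p\<in>UNIV. \<Sum>q\<in>UNIV. \<Sum>r\<in>UNIV. \<Sum>s\<in>UNIV.
     g$i$p * g$j$q * g$k$r * g$l$s * T$p$q$r$s)"
  by (simp add: act4_def)

lemma sum_swap_pairs: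
  "(\<Sum>p\<in>A. \<Sum>q\<in>B. \<Sum>r\<in>C. \<Sum>s\<in>D. f p q r s) = (\<Sum>r\<in>C. \<Sum>s\<in>D. \<Sum>p\<in>A. \<Sum>q\<in>B. f p q r s)"
proof -
  have "(\<Sum>p\<in>A. \<Sum>q\<in>B. \<Sum>r\<in>C. \<Sum>s\<in>D. f p q r s) = (\<Sum>p\<in>A. \<Sum>r\<in>C. \<Sum>s\<in>D. \<Sum>q\<in>B. f p q r s)"
    by (rule sum.cong[OF refl], subst sum.swap, rule sum.cong[OF refl], rule sum.swap)
  also have "\<dots> = (\<Sum>r\<in>C. \<Sum>s\<in>D. \<Sum>p\<in>A. \<Sum>q\<in>B. f p q r s)"
    by (subst sum.swap, rule sum.cong[OF refl], rule sum.swap)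
  finally show ?thesis .
qed

lemma act4_mult: "act4 (A ** B) T = act4 A (act4 B T)"
proof -
  have prod4: "(\<Sum>a\<in>UNIV. f a) * (\<Sum>b\<in>UNIV. g b) * (\<Sum>c\<in>UNIV. h c) * (\<Sum>d\<in>UNIV. k d) * t
     = (\<Sum>a\<in>UNIV. \<Sum>b\<in>UNIV. \<Sum>c\<in>UNIV. \<Sum>d\<in>UNIV. f a * g b * h c * k d * t)"
    for f g h k :: "3 \<Rightarrow> real" and t
    by (simp only: mult.assoc flip: sum_distrib_left sum_distrib_right)
  have "act4 (A ** B) T $ i $ j $ k $ l = act4 A (act4 B T) $ i $ j $ k $ l" for i j k l
  proof -
    \<comment> \<open>The inner summations over \<open>a, b, c, d\<close> are moved outside, two at a time.\<close>
    let ?F = "\<lambda>p q r s a b c d. A$i$a * B$a$p * (A$j$b * B$b$q) * (A$k$c * B$c$r) * (A$l$d * B$d$s) * T$p$q$r$s"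
    have "act4 (A ** B) T $ i $ j $ k $ l = (\<Sum>p\<in>UNIV. \<Sum>q\<in>UNIV. \<Sum>r\<in>UNIV. \<Sum>s\<in>UNIV. \<Sum>a\<in>UNIV. \<Sum>b\<in>UNIV. \<Sum>c\<in>UNIV. \<Sum>d\<in>UNIV. ?F p q r s a b c d)"
      unfolding act4_nth matrix_matrix_mult_def vec_lambda_beta prod4 ..
    also have "\<dots> = (\<Sum>p\<in>UNIV. \<Sum>q\<in>UNIV. \<Sum>a\<in>UNIV. \<Sum>b\<in>UNIV. \<Sum>r\<in>UNIV. \<Sum>s\<in>UNIV. \<Sum>c\<in>UNIV. \<Sum>d\<in>UNIV. ?F p q r s a b c d)"
      by (rule sum.cong[OF refl], rule sum.cong[OF refl], rule sum_swap_pairs)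
    also have "\<dots> = (\<Sum>a\<in>UNIV. \<Sum>b\<in>UNIV. \<Sum>p\<in>UNIV. \<Sum>q\<in>UNIV. \<Sum>r\<in>UNIV. \<Sum>s\<in>UNIV. \<Sum>c\<in>UNIV. \<Sum>d\<in>UNIV. ?F p q r s a b c d)"
      by (rule sum_swap_pairs)
    also have "\<dots> = (\<Sum>a\<in>UNIV. \<Sum>b\<in>UNIV. \<Sum>p\<in>UNIV. \<Sum>q\<in>UNIV. \<Sum>c\<in>UNIV. \<Sum>d\<in>UNIV. \<Sum>r\<in>UNIV. \<Sum>s\<in>UNIV. ?F p q r s a b c d)"
      by (rule sum.cong[OF refl], rule sum.cong[OF refl], rule sum.cong[OF refl], rule sum.cong[OF refl], rule sum_swap_pairs)
    also have "\<dots> = (\<Sum>a\<in>UNIV. \<Sum>b\<in>UNIV. \<Sum>c\<in>UNIV. \<Sum>d\<in>UNIV. \<Sum>p\<in>UNIV. \<Sum>q\<in>UNIV. \<Sum>r\<in>UNIV. \<Sum>s\<in>UNIV. ?F p q r s a b c d)"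
      by (rule sum.cong[OF refl], rule sum.cong[OF refl], rule sum_swap_pairs)
    also have "\<dots> = act4 A (act4 B T) $ i $ j $ k $ l"
      unfolding act4_nth sum_distrib_left by (simp only: ac_simps)
    finally show ?thesis .
  qed
  then show ?thesis by (simp add: vec_eq_iff)
qed

lemma act4_one: "act4 (mat 1) T = T"
  by (simp add: vec_eq_iff act4_nth mat_def if_distrib[of "\<lambda>x. x * _"] if_distrib[of "\<lambda>x. _ * x"] cong: if_cong)

lemma act4_add: "act4 g (S + T) = act4 g S + act4 g T"
  by (simp add: vec_eq_iff act4_nth sum.distrib distrib_left)

lemma act4_scaleR: "act4 g (c *\<^sub>R T) = c *\<^sub>R act4 g T"
  by (simp add: vec_eq_iff act4_nth sum_distrib_left mult.left_commute)

lemma act4_Ela: assumes "E \<in> Ela" shows "act4 g E \<in> Ela"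
proof -
  have E: "E$i$j$k$l = E$k$l$i$j" "E$i$j$k$l = E$j$i$k$l" for i j k l
    using assms by (auto simp: Ela_def)
  have "act4 g E $ i $ j $ k $ l = act4 g E $ j $ i $ k $ l" for i j k l
    unfolding act4_nth by (subst sum.swap) (simp add: E(2) ac_simps)
  moreover have "act4 g E $ i $ j $ k $ l = act4 g E $ k $ l $ i $ j" for i j k l
    unfolding act4_nth by (subst sum_swap_pairs) (simp add: E(1) ac_simps)
  ultimately show ?thesis by (auto simp: Ela_def)
qed

section \<open>Transversely isotropic tensors with a given axis\<close>

text \<open>The dyad \<open>n \<otimes> n\<close> and, for a unit vector \<open>n\<close>, its deviator.\<close>

definition dyad :: "real^3 \<Rightarrow> tensor2" where "dyad n = (\<chi> i j. n$i * n$j)"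

definition dyad_dev :: "real^3 \<Rightarrow> tensor2" where "dyad_dev n = dyad n - (1/3) *\<^sub>R mat 1"

text \<open>The tensors with components \<open>a\<^sub>i\<^sub>k b\<^sub>j\<^sub>l\<close> and \<open>a\<^sub>i\<^sub>l b\<^sub>j\<^sub>k\<close>: the first factor
  carries the indices 1 and 3, respectively 1 and 4.\<close>

definition tensor_prod13 :: "tensor2 \<Rightarrow> tensor2 \<Rightarrow> tensor4" where
  "tensor_prod13 a b = (\<chi> i j k l. a$i$k * b$j$l)"

definition tensor_prod14 :: "tensor2 \<Rightarrow> tensor2 \<Rightarrow> tensor4" where
  "tensor_prod14 a b = (\<chi> i j k l. a$i$l * b$j$k)"

text \<open>The general combination of the metric and \<open>n \<otimes> n\<close> with the symmetries of an elasticity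
  tensor; its axis \<open>n\<close> is meant to be a unit vector.\<close>

definition ti_tensor :: "real \<Rightarrow> real \<Rightarrow> real \<Rightarrow> real \<Rightarrow> real \<Rightarrow> real^3 \<Rightarrow> tensor4" where
  "ti_tensor c1 c2 c3 c4 c5 n = (let q = mat 1; N = dyad n in
     c1 *\<^sub>R tensor_prod q q
   + c2 *\<^sub>R (tensor_prod13 q q + tensor_prod14 q q)
   + c3 *\<^sub>R (tensor_prod q N + tensor_prod N q)
   + c4 *\<^sub>R (tensor_prod13 q N + tensor_prod14 q N + tensor_prod14 N q + tensor_prod13 N q)
   + c5 *\<^sub>R tensor_prod N N)"

lemma ti_tensor_nth: "ti_tensor c1 c2 c3 c4 c5 n $ i $ j $ k $ l =
     c1 * (mat 1$i$j * mat 1$k$l)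
   + c2 * (mat 1$i$k * mat 1$j$l + mat 1$i$l * mat 1$j$k)
   + c3 * (mat 1$i$j * (n$k * n$l) + mat 1$k$l * (n$i * n$j))
   + c4 * (mat 1$i$k * (n$j * n$l) + mat 1$i$l * (n$j * n$k)
         + mat 1$j$k * (n$i * n$l) + mat 1$j$l * (n$i * n$k))
   + c5 * (n$i * n$j * (n$k * n$l))"
  by (simp add: ti_tensor_def Let_def tensor_prod_def tensor_prod13_def tensor_prod14_def dyad_def algebra_simps)

lemma conj_nth: "(g ** a ** transpose g) $ i $ j = (\<Sum>p\<in>UNIV. \<Sum>q\<in>UNIV. g$i$p * g$j$q * (a::tensor2)$p$q)"
proof -
  have "(g ** a ** transpose g) $ i $ j = (\<Sum>q\<in>UNIV. \<Sum>p\<in>UNIV. g$i$p * g$j$q * a$p$q)"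
    by (simp add: matrix_matrix_mult_def transpose_def sum_distrib_left sum_distrib_right ac_simps)
  also have "\<dots> = (\<Sum>p\<in>UNIV. \<Sum>q\<in>UNIV. g$i$p * g$j$q * a$p$q)" by (rule sum.swap)
  finally show ?thesis .
qed

lemma act4_tensor_prod13:
  "act4 g (tensor_prod13 a b) = tensor_prod13 (g ** a ** transpose g) (g ** b ** transpose g)"
  by (simp add: vec_eq_iff act4_nth tensor_prod13_def conj_nth sum_product ac_simps)

lemma act4_tensor_prod14:
  "act4 g (tensor_prod14 a b) = tensor_prod14 (g ** a ** transpose g) (g ** b ** transpose g)"
proof -
  have "(\<Sum>p\<in>UNIV. \<Sum>q\<in>UNIV. \<Sum>r\<in>UNIV. \<Sum>s\<in>UNIV. g$i$p * g$j$q * g$k$r * g$l$s * (a$p$s * b$q$r))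
     = (\<Sum>p\<in>UNIV. \<Sum>q\<in>UNIV. \<Sum>s\<in>UNIV. \<Sum>r\<in>UNIV. g$i$p * g$l$s * a$p$s * (g$j$q * g$k$r * b$q$r))" for i j k l
    by (rule sum.cong[OF refl], rule sum.cong[OF refl], subst sum.swap) (simp add: ac_simps)
  then show ?thesis
    by (simp add: vec_eq_iff act4_nth tensor_prod14_def conj_nth sum_product)
qed

lemma act4_tensor_prod:
  "act4 g (tensor_prod a b) = tensor_prod (g ** a ** transpose g) (g ** b ** transpose g)"
proof -
  have "(\<Sum>p\<in>UNIV. \<Sum>q\<in>UNIV. \<Sum>r\<in>UNIV. \<Sum>s\<in>UNIV. g$i$p * g$j$q * g$k$r * g$l$s * (a$p$q * b$r$s))
     = (\<Sum>p\<in>UNIV. \<Sum>r\<in>UNIV. \<Sum>q\<in>UNIV. \<Sum>s\<in>UNIV. g$i$p * g$j$q * a$p$q * (g$k$r * g$l$s * b$r$s))" for i j k l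
    by (rule sum.cong[OF refl], subst sum.swap) (simp add: ac_simps)
  then show ?thesis
    by (simp add: vec_eq_iff act4_nth tensor_prod_def conj_nth sum_product)
qed

lemma conj_dyad: "g ** dyad n ** transpose g = dyad (g *v n)"
  by (simp add: vec_eq_iff conj_nth dyad_def matrix_vector_mult_def sum_product ac_simps)

lemma act4_ti_tensor:
  assumes "orthogonal_matrix g"
  shows "act4 g (ti_tensor c1 c2 c3 c4 c5 n) = ti_tensor c1 c2 c3 c4 c5 (g *v n)"
proof -
  have "g ** mat 1 ** transpose g = mat 1"
    using assms by (simp add: orthogonal_matrix_def)
  then show ?thesis
    by (simp add: ti_tensor_def Let_def act4_add act4_scaleR act4_tensor_prod act4_tensor_prod13 act4_tensor_prod14 conj_dyad)
qed

lemma ti_tensor_in_Ela: "ti_tensor c1 c2 c3 c4 c5 n \<in> Ela"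
proof -
  have "(mat 1 :: tensor2) $ i $ j = mat 1 $ j $ i" for i j by (simp add: mat_def)
  then show ?thesis
  unfolding Ela_def by (simp add: ti_tensor_nth algebra_simps)
qed

section \<open>Harmonic components of the transversely isotropic tensors\<close>

lemma d_ti_tensor:
  assumes "norm n = 1"
  shows "d_tens (ti_tensor c1 c2 c3 c4 c5 n) = (3*c1+2*c2+c3) *\<^sub>R mat 1 + (3*c3+4*c4+c5) *\<^sub>R dyad n"
  unfolding vec_eq_iff forall_3 using unit_vector_components[OF assms]
  by (simp add: d_tens_def ti_tensor_nth sum_3 dyad_def kron_components) (intro conjI; algebra)

lemma v_ti_tensor:
  assumes "norm n = 1"
  shows "v_tens (ti_tensor c1 c2 c3 c4 c5 n) = (c1+4*c2+c4) *\<^sub>R mat 1 + (2*c3+5*c4+c5) *\<^sub>R dyad n"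
  unfolding vec_eq_iff forall_3 using unit_vector_components[OF assms]
  by (simp add: v_tens_def ti_tensor_nth sum_3 dyad_def kron_components) (intro conjI; algebra)

lemma trace_dyad: "norm n = 1 \<Longrightarrow> trace (dyad n) = 1"
  by (simp add: trace_def sum_3 dyad_def unit_vector_components)

lemma trace_mat_1: "trace (mat 1 :: tensor2) = 3" by (simp add: trace_def sum_3 kron_components)

lemma trace_scaleR: "trace (x *\<^sub>R (a::tensor2)) = x * trace a"
  by (simp add: trace_def sum_distrib_left)

lemma dev_mat_plus_dyad:
  assumes "norm n = 1"
  shows "dev (x *\<^sub>R mat 1 + y *\<^sub>R dyad n) = y *\<^sub>R dyad_dev n"
  using assms unfolding dev_def dyad_dev_def
  by (simp add: trace_add trace_scaleR trace_mat_1 trace_dyad algebra_simps)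

lemma dev_scaleR: "dev (x *\<^sub>R a) = x *\<^sub>R dev a"
  by (simp add: dev_def trace_scaleR algebra_simps)

text \<open>The harmonic part of \<open>n \<otimes> n \<otimes> n \<otimes> n\<close> for a unit vector \<open>n\<close>; the coefficients \<open>1/7\<close>
  and \<open>1/35\<close> make it traceless.\<close>

definition harmonic_quartic :: "real^3 \<Rightarrow> tensor4" where
  "harmonic_quartic n = (\<chi> i j k l. n$i * n$j * (n$k * n$l)
     - (1/7) * (mat 1$i$j * (n$k * n$l) + mat 1$k$l * (n$i * n$j)
         + mat 1$i$k * (n$j * n$l) + mat 1$i$l * (n$j * n$k)
         + mat 1$j$k * (n$i * n$l) + mat 1$j$l * (n$i * n$k))
     + (1/35) * (mat 1$i$j * mat 1$k$l + mat 1$i$k * mat 1$j$l + mat 1$i$l * mat 1$j$k))"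

lemma H_ti_tensor:
  assumes "norm n = 1"
  shows "H_tens (ti_tensor c1 c2 c3 c4 c5 n) = c5 *\<^sub>R harmonic_quartic n"
proof -
  define T where "T = ti_tensor c1 c2 c3 c4 c5 n"
  have a: "a_tens T = ((2/7) * (5*c1+10*c2+c3+2*c4)) *\<^sub>R mat 1 + ((2/7) * (7*c3+14*c4+3*c5)) *\<^sub>R dyad n"
    by (simp add: T_def a_tens_def d_ti_tensor[OF assms] v_ti_tensor[OF assms] algebra_simps
        flip: scaleR_add_left)
  have "dev (a_tens T) = ((2/7) * (7*c3+14*c4+3*c5)) *\<^sub>R dyad_dev n"
    unfolding a using dev_mat_plus_dyad[OF assms] .
  moreover have "trace (a_tens T) = (2/7) * (3*(5*c1+10*c2+c3+2*c4) + (7*c3+14*c4+3*c5))"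
    by (simp add: a trace_add trace_scaleR trace_mat_1 trace_dyad assms algebra_simps)
  moreover have key: "tsym T $ i $ j $ k $ l - sym_prod (mat 1) (((2/7) * (7*c3+14*c4+3*c5)) *\<^sub>R dyad_dev n) $ i $ j $ k $ l
      - 7/30 * ((2/7) * (3*(5*c1+10*c2+c3+2*c4) + (7*c3+14*c4+3*c5))) * sym_prod (mat 1) (mat 1) $ i $ j $ k $ l
     = c5 * harmonic_quartic n $ i $ j $ k $ l" for i j k l
    unfolding tsym_nth sym_prod_def T_def
    by (simp add: tensor_prod_def ti_tensor_nth harmonic_quartic_def dyad_dev_def dyad_def kron_commute[of j i] kron_commute[of k i] kron_commute[of l i]
       kron_commute[of k j] kron_commute[of l j] kron_commute[of l k] field_simps)
  ultimately have "H_tens T $ i $ j $ k $ l = c5 * harmonic_quartic n $ i $ j $ k $ l" for i j k l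
    unfolding H_tens_def by (simp only: vector_minus_component vector_scaleR_component real_scaleR_def)
  then show ?thesis unfolding T_def[symmetric] vec_eq_iff by simp
qed

lemma harmonic_quartic_sym: "harmonic_quartic n $ j $ i $ k $ l = harmonic_quartic n $ i $ j $ k $ l"
  "harmonic_quartic n $ i $ k $ j $ l = harmonic_quartic n $ i $ j $ k $ l"
  "harmonic_quartic n $ i $ j $ l $ k = harmonic_quartic n $ i $ j $ k $ l"
  by (simp_all add: harmonic_quartic_def kron_commute[of j i] kron_commute[of k j] kron_commute[of l k] algebra_simps)

lemma harmonic_quartic_trace:
  assumes "norm n = 1"
  shows "(\<Sum>k\<in>UNIV. harmonic_quartic n $ i $ j $ k $ k) = 0"
proof -
  have "(\<Sum>k\<in>UNIV. harmonic_quartic n $ i $ j $ k $ k) =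
      n$i * n$j * (n$1 * n$1 + n$2 * n$2 + n$3 * n$3)
      - (1/7) * (mat 1$i$j * (n$1 * n$1 + n$2 * n$2 + n$3 * n$3) + 3 * (n$i * n$j)
        + 2 * n$j * (mat 1$i$1 * n$1 + mat 1$i$2 * n$2 + mat 1$i$3 * n$3)
        + 2 * n$i * (mat 1$j$1 * n$1 + mat 1$j$2 * n$2 + mat 1$j$3 * n$3))
      + (1/35) * (3 * mat 1$i$j + 2 * (mat 1$i$1 * mat 1$j$1 + mat 1$i$2 * mat 1$j$2 + mat 1$i$3 * mat 1$j$3))"
    by (simp add: sum_3 harmonic_quartic_def kron_components field_simps)
  then show ?thesis
    unfolding unit_vector_components[OF assms] kron_contract_vector kron_contract_kron by (simp add: kron_commute[of j i] field_simps)
qed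

lemma harmonic_quartic_contract1:
  assumes "norm n = 1"
  shows "(\<Sum>l\<in>UNIV. harmonic_quartic n $ i $ j $ k $ l * n $ l)
   = (4/7) * (n$i * n$j * n$k) - (4/35) * (mat 1$i$j * n$k + mat 1$i$k * n$j + mat 1$j$k * n$i)"
proof -
  have "(\<Sum>l\<in>UNIV. harmonic_quartic n $ i $ j $ k $ l * n $ l) =
      n$i * n$j * n$k * (n$1 * n$1 + n$2 * n$2 + n$3 * n$3)
      - (1/7) * ((mat 1$i$j * n$k + mat 1$i$k * n$j + mat 1$j$k * n$i) * (n$1 * n$1 + n$2 * n$2 + n$3 * n$3)
        + n$i * n$j * (mat 1$k$1 * n$1 + mat 1$k$2 * n$2 + mat 1$k$3 * n$3)
        + n$j * n$k * (mat 1$i$1 * n$1 + mat 1$i$2 * n$2 + mat 1$i$3 * n$3)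
        + n$i * n$k * (mat 1$j$1 * n$1 + mat 1$j$2 * n$2 + mat 1$j$3 * n$3))
      + (1/35) * (mat 1$i$j * (mat 1$k$1 * n$1 + mat 1$k$2 * n$2 + mat 1$k$3 * n$3)
        + mat 1$j$k * (mat 1$i$1 * n$1 + mat 1$i$2 * n$2 + mat 1$i$3 * n$3)
        + mat 1$i$k * (mat 1$j$1 * n$1 + mat 1$j$2 * n$2 + mat 1$j$3 * n$3))"
    by (simp add: sum_3 harmonic_quartic_def field_simps)
  then show ?thesis
    unfolding unit_vector_components[OF assms] kron_contract_vector by (simp add: field_simps)
qed

lemma harmonic_quartic_contract2:
  assumes "norm n = 1"
  shows "(\<Sum>k\<in>UNIV. \<Sum>l\<in>UNIV. harmonic_quartic n $ i $ j $ k $ l * n $ k * n $ l)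
   = (12/35) * (n$i * n$j) - (4/35) * mat 1$i$j"
proof -
  have "(\<Sum>k\<in>UNIV. \<Sum>l\<in>UNIV. harmonic_quartic n $ i $ j $ k $ l * n $ k * n $ l)
    = (\<Sum>k\<in>UNIV. (\<Sum>l\<in>UNIV. harmonic_quartic n $ i $ j $ k $ l * n $ l) * n $ k)"
    by (simp add: sum_distrib_left sum_distrib_right mult.assoc mult.left_commute mult.commute)
  also have "\<dots> = (4/7) * (n$i * n$j) * (n$1 * n$1 + n$2 * n$2 + n$3 * n$3)
     - (4/35) * (mat 1$i$j * (n$1 * n$1 + n$2 * n$2 + n$3 * n$3)
        + n$j * (mat 1$i$1 * n$1 + mat 1$i$2 * n$2 + mat 1$i$3 * n$3)
        + n$i * (mat 1$j$1 * n$1 + mat 1$j$2 * n$2 + mat 1$j$3 * n$3))"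
    unfolding harmonic_quartic_contract1[OF assms] by (simp add: sum_3 field_simps)
  finally show ?thesis
    unfolding unit_vector_components[OF assms] kron_contract_vector by (simp add: field_simps)
qed

text \<open>Against a totally symmetric traceless tensor, every term of \<open>harmonic_quartic\<close> with a
  metric contracting two of the summed indices vanishes.\<close>

lemma harmonic_quartic_contract3:
  fixes A :: "3 \<Rightarrow> 3 \<Rightarrow> 3 \<Rightarrow> real"
  assumes s1: "\<And>p q r. A q p r = A p q r" and s2: "\<And>p q r. A p r q = A p q r"
    and tr: "\<And>p. (\<Sum>q\<in>UNIV. A p q q) = 0"
  shows "(\<Sum>p\<in>UNIV. \<Sum>q\<in>UNIV. \<Sum>r\<in>UNIV. A p q r * harmonic_quartic n $ p $ q $ r $ j) =
    n$j * (\<Sum>p\<in>UNIV. \<Sum>q\<in>UNIV. \<Sum>r\<in>UNIV. A p q r * n$p * n$q * n$r)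
    - (3/7) * (\<Sum>p\<in>UNIV. \<Sum>q\<in>UNIV. A j p q * n$p * n$q)"
proof -
  \<comment> \<open>Tracelessness and symmetry leave seven independent entries of \<open>A\<close>.\<close>
  have last: "A p 3 3 = - A p 1 1 - A p 2 2" for p
    using tr[of p] by (simp add: sum_3)
  note sorted = s1[where p = 1 and q = 2] s1[where p = 1 and q = 3] s1[where p = 2 and q = 3]
    s2[where q = 1 and r = 2] s2[where q = 1 and r = 3] s2[where q = 2 and r = 3]
  \<comment> \<open>The argument does not use the values of the two coefficients, and with them left symbolic the
    identity to be checked is one between polynomials with integer coefficients.\<close>
  define \<alpha> \<beta> :: real where "\<alpha> = 1/7" and "\<beta> = 1/35"
  have K: "harmonic_quartic n $ p $ q $ r $ j = n$p * n$q * (n$r * n$j)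
     - \<alpha> * (mat 1$p$q * (n$r * n$j) + mat 1$r$j * (n$p * n$q)
         + mat 1$p$r * (n$q * n$j) + mat 1$p$j * (n$q * n$r)
         + mat 1$q$r * (n$p * n$j) + mat 1$q$j * (n$p * n$r))
     + \<beta> * (mat 1$p$q * mat 1$r$j + mat 1$p$r * mat 1$q$j + mat 1$p$j * mat 1$q$r)" for p q r j
    by (simp add: harmonic_quartic_def \<alpha>_def \<beta>_def)
  have "\<forall>j. (\<Sum>p\<in>UNIV. \<Sum>q\<in>UNIV. \<Sum>r\<in>UNIV. A p q r * harmonic_quartic n $ p $ q $ r $ j) =
    n$j * (\<Sum>p\<in>UNIV. \<Sum>q\<in>UNIV. \<Sum>r\<in>UNIV. A p q r * n$p * n$q * n$r)
    - 3 * \<alpha> * (\<Sum>p\<in>UNIV. \<Sum>q\<in>UNIV. A j p q * n$p * n$q)"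
    unfolding forall_3 K
    by (simp add: sum_3 sorted kron_components last) (simp add: algebra_simps)
  then show ?thesis by (simp add: \<alpha>_def)
qed

lemma d2_ti_tensor:
  assumes "norm n = 1"
  shows "d2_tens (ti_tensor c1 c2 c3 c4 c5 n) =
   (12/245 * c5^2) *\<^sub>R mat 1 + (4/49 * c5^2) *\<^sub>R dyad n"
proof -
  have *: "(\<Sum>p\<in>UNIV. \<Sum>q\<in>UNIV. \<Sum>r\<in>UNIV. harmonic_quartic n $ i $ p $ q $ r * harmonic_quartic n $ p $ q $ r $ j)
    = 12/245 * mat 1 $ i $ j + 4/49 * (n $ i * n $ j)" for i j
  proof -
    have nnn: "(\<Sum>p\<in>UNIV. \<Sum>q\<in>UNIV. \<Sum>r\<in>UNIV. harmonic_quartic n $ i $ p $ q $ r * n$p * n$q * n$r) = 8/35 * n $ i"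
    proof -
      have "(\<Sum>p\<in>UNIV. \<Sum>q\<in>UNIV. \<Sum>r\<in>UNIV. harmonic_quartic n $ i $ p $ q $ r * n$p * n$q * n$r)
        = (\<Sum>p\<in>UNIV. (\<Sum>q\<in>UNIV. \<Sum>r\<in>UNIV. harmonic_quartic n $ i $ p $ q $ r * n$q * n$r) * n$p)"
        by (simp add: sum_distrib_left sum_distrib_right mult.assoc mult.left_commute mult.commute)
      also have "\<dots> = 12/35 * n$i * (n$1 * n$1 + n$2 * n$2 + n$3 * n$3) - 4/35 * (mat 1$i$1 * n$1 + mat 1$i$2 * n$2 + mat 1$i$3 * n$3)"
         unfolding harmonic_quartic_contract2[OF assms] by (simp add: sum_3 field_simps)
      finally show ?thesis
        unfolding unit_vector_components[OF assms] kron_contract_vector by (simp add: field_simps)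
    qed
    have s: "harmonic_quartic n $ i $ p $ q $ j = harmonic_quartic n $ i $ j $ p $ q" for p q
      by (simp add: harmonic_quartic_sym(2)[of n i j p q] harmonic_quartic_sym(3)[of n i p j q])
    have nnj: "(\<Sum>p\<in>UNIV. \<Sum>q\<in>UNIV. harmonic_quartic n $ i $ p $ q $ j * n $ p * n $ q) = 12/35 * (n $ i * n $ j) - 4/35 * mat 1 $ i $ j"
      unfolding s by (rule harmonic_quartic_contract2[OF assms])
    have "(\<Sum>p\<in>UNIV. \<Sum>q\<in>UNIV. \<Sum>r\<in>UNIV. harmonic_quartic n $ i $ p $ q $ r * harmonic_quartic n $ p $ q $ r $ j) =
        n$j * (8/35 * n $ i) - (3/7) * (12/35 * (n $ i * n $ j) - 4/35 * mat 1 $ i $ j)"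
      using harmonic_quartic_contract3[of "\<lambda>p q r. harmonic_quartic n $ i $ p $ q $ r" n j]
      unfolding nnn nnj[unfolded s] by (simp add: assms harmonic_quartic_trace harmonic_quartic_sym(2,3)[of n i])
    then show ?thesis by (simp add: field_simps)
  qed
  have "d2_tens (ti_tensor c1 c2 c3 c4 c5 n) $ i $ j =
      c5\<^sup>2 * (\<Sum>p\<in>UNIV. \<Sum>q\<in>UNIV. \<Sum>r\<in>UNIV. harmonic_quartic n $ i $ p $ q $ r * harmonic_quartic n $ p $ q $ r $ j)" for i j
    by (simp add: d2_tens_def H_ti_tensor[OF assms] sum_distrib_left power2_eq_square ac_simps)
  then show ?thesis
    by (simp add: vec_eq_iff * dyad_def algebra_simps)
qed

section \<open>The tensor t and the five invariants\<close>

lemma norm_dyad_dev: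
  assumes "norm n = 1"
  shows "norm (dyad_dev n) ^ 2 = 2/3"
proof -
  have "dyad_dev n \<bullet> dyad_dev n = (n$1 * n$1 + n$2 * n$2 + n$3 * n$3)^2 - (2/3) * (n$1 * n$1 + n$2 * n$2 + n$3 * n$3) + 1/3"
    by (simp add: inner_vec_def dyad_dev_def dyad_def kron_components sum_3 power2_eq_square field_simps)
  then show ?thesis using unit_vector_components[OF assms] by (simp add: power2_norm_eq_inner)
qed

lemma dyad_idempotent:
  assumes "norm n = 1"
  shows "dyad n ** dyad n = dyad n"
proof -
  have "(dyad n ** dyad n) $ i $ j = n$i * n$j * (n$1 * n$1 + n$2 * n$2 + n$3 * n$3)" for i j
    by (simp add: matrix_matrix_mult_def sum_3 dyad_def algebra_simps)
  then show ?thesis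
    unfolding unit_vector_components[OF assms] by (simp add: vec_eq_iff dyad_def)
qed

lemma dyad_dev_square:
  assumes "norm n = 1"
  shows "dyad_dev n ** dyad_dev n = (1/9) *\<^sub>R mat 1 + (1/3) *\<^sub>R dyad n"
proof -
  have "(dyad_dev n ** dyad_dev n) $ i $ j = (dyad n ** dyad n) $ i $ j + (1/9) * mat 1 $ i $ j - (2/3) * dyad n $ i $ j" for i j
  proof -
    have "\<forall>i j. (dyad_dev n ** dyad_dev n) $ i $ j = (dyad n ** dyad n) $ i $ j + (1/9) * mat 1 $ i $ j - (2/3) * dyad n $ i $ j"
      unfolding dyad_dev_def forall_3 by (simp add: matrix_matrix_mult_def sum_3 kron_components field_simps)
    then show ?thesis by blast
  qed
  then show ?thesis unfolding dyad_idempotent[OF assms] by (simp add: vec_eq_iff)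
qed

text \<open>The condition that \<open>ti_tensor c1 c2 c3 c4 c5 n\<close> is not isotropic: the coefficients of \<open>dyad n\<close> in \<open>d\<close> and in \<open>v\<close> and the
  coefficient of \<open>harmonic_quartic n\<close> in \<open>H\<close> do not all vanish.\<close>

definition nondegenerate :: "real \<Rightarrow> real \<Rightarrow> real \<Rightarrow> bool" where
  "nondegenerate c3 c4 c5 \<longleftrightarrow> \<not> (3*c3+4*c4+c5 = 0 \<and> 2*c3+5*c4+c5 = 0 \<and> c5 = 0)"

text \<open>Numerator and denominator of \<open>t\<close>, as polynomial functions of the elasticity tensor and
  without the factor 2.\<close>

definition t_denominator :: "tensor4 \<Rightarrow> real" where
  "t_denominator E = norm (dev (d_tens E)) ^ 4 + norm (dev (v_tens E)) ^ 4 + (norm (dev (d2_tens E)))\<^sup>2"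

definition t_numerator :: "tensor4 \<Rightarrow> tensor2" where
  "t_numerator E = dev ((norm (dev (d_tens E)))\<^sup>2 *\<^sub>R (dev (d_tens E) ** dev (d_tens E))
     + (norm (dev (v_tens E)))\<^sup>2 *\<^sub>R (dev (v_tens E) ** dev (v_tens E))
     + dev (d2_tens E) ** dev (d2_tens E))"

lemma t_tens_eq: "t_tens E = (2 / t_denominator E) *\<^sub>R t_numerator E"
  by (simp add: t_tens_def t_denominator_def t_numerator_def Let_def)

lemma matrix_mult_scaleR: "(x *\<^sub>R a) ** (y *\<^sub>R b) = (x * y) *\<^sub>R (a ** (b::tensor2))"
  by (simp add: vec_eq_iff matrix_matrix_mult_def sum_distrib_left ac_simps)

text \<open>Let \<open>B = dyad_dev n\<close>.  The deviators \<open>x B\<close>, \<open>y B\<close>, \<open>z B\<close> of \<open>d\<close>, \<open>v\<close>, \<open>d2\<close> enter the denominator as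
  \<open>(2/3) S\<close> and the numerator as \<open>(S/3) B\<close>, with the same \<open>S = (2/3) x^4 + (2/3) y^4 + z^2\<close>.\<close>

lemma t_ti_tensor:
  assumes n: "norm n = 1" and nd: "nondegenerate c3 c4 c5"
  shows "t_denominator (ti_tensor c1 c2 c3 c4 c5 n) \<noteq> 0" and "t_tens (ti_tensor c1 c2 c3 c4 c5 n) = dyad_dev n"
proof -
  define x y z where "x = 3*c3+4*c4+c5" and "y = 2*c3+5*c4+c5" and "z = 4/49 * c5\<^sup>2"
  define S where "S = 2/3 * x^4 + 2/3 * y^4 + z\<^sup>2"
  have dev: "dev (d_tens (ti_tensor c1 c2 c3 c4 c5 n)) = x *\<^sub>R dyad_dev n"
    "dev (v_tens (ti_tensor c1 c2 c3 c4 c5 n)) = y *\<^sub>R dyad_dev n"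
    "dev (d2_tens (ti_tensor c1 c2 c3 c4 c5 n)) = z *\<^sub>R dyad_dev n"
    unfolding d_ti_tensor[OF n] v_ti_tensor[OF n] d2_ti_tensor[OF n] dev_mat_plus_dyad[OF n] x_def y_def z_def by simp_all
  have norm2: "(norm (w *\<^sub>R dyad_dev n))\<^sup>2 = 2/3 * w\<^sup>2" for w
    using norm_dyad_dev[OF n] by (simp add: power_mult_distrib)
  have norm4: "norm (w *\<^sub>R dyad_dev n) ^ 4 = 4/9 * w^4" for w
  proof -
    have "norm (w *\<^sub>R dyad_dev n) ^ 4 = ((norm (w *\<^sub>R dyad_dev n))\<^sup>2)\<^sup>2" by simp
    then show ?thesis unfolding norm2 by (simp add: power_mult_distrib power_divide flip: power_mult)
  qed
  have den: "t_denominator (ti_tensor c1 c2 c3 c4 c5 n) = 2/3 * S"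
    unfolding t_denominator_def dev norm2 norm4 S_def by simp
  have num: "t_numerator (ti_tensor c1 c2 c3 c4 c5 n) = (S/3) *\<^sub>R dyad_dev n"
  proof -
    have "t_numerator (ti_tensor c1 c2 c3 c4 c5 n) = dev (S *\<^sub>R (dyad_dev n ** dyad_dev n))"
      unfolding t_numerator_def dev norm2 matrix_mult_scaleR S_def
      by (simp add: scaleR_add_left power4_eq_xxxx power2_eq_square ac_simps)
    then show ?thesis by (simp add: dev_scaleR dyad_dev_square[OF n] dev_mat_plus_dyad[OF n])
  qed
  have "S > 0"
  proof -
    have "x \<noteq> 0 \<or> y \<noteq> 0 \<or> z \<noteq> 0"
      using nd by (auto simp: nondegenerate_def x_def y_def z_def)
    then have "x^4 > 0 \<or> y^4 > 0 \<or> z\<^sup>2 > 0" by auto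
    moreover have "x^4 \<ge> 0" "y^4 \<ge> 0" "z\<^sup>2 \<ge> 0" by simp_all
    ultimately show ?thesis unfolding S_def by linarith
  qed
  then show "t_denominator (ti_tensor c1 c2 c3 c4 c5 n) \<noteq> 0" "t_tens (ti_tensor c1 c2 c3 c4 c5 n) = dyad_dev n"
    unfolding t_tens_eq den num by simp_all
qed

lemma dyad_dev_harmonic: "norm n = 1 \<Longrightarrow> dyad_dev n \<in> harmonic2"
  by (simp add: harmonic2_def dyad_dev_def trace_sub trace_scaleR trace_mat_1 trace_dyad)
     (simp add: vec_eq_iff transpose_def dyad_def mat_def)

lemma inner_dyad_dev:
  assumes "norm n = 1"
  shows "(x *\<^sub>R mat 1 + y *\<^sub>R dyad n) \<bullet> dyad_dev n = 2/3 * y"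
proof -
  have tr: "mat 1 \<bullet> a = trace a" for a :: tensor2
    by (simp add: inner_vec_def sum_3 kron_components trace_def)
  have "trace (dyad_dev n) = 0" using dyad_dev_harmonic[OF assms] by (simp add: harmonic2_def)
  moreover have "dyad n = dyad_dev n + (1/3) *\<^sub>R mat 1" by (simp add: dyad_dev_def)
  moreover have "dyad_dev n \<bullet> dyad_dev n = 2/3" using norm_dyad_dev[OF assms] by (simp add: power2_norm_eq_inner)
  ultimately show ?thesis by (simp add: inner_add_left tr)
qed

lemma contract_harmonic_quartic:
  assumes n: "norm n = 1"
  shows "contract (dyad_dev n) (harmonic_quartic n) (dyad_dev n) = 8/35"
proof -
  have M: "(\<Sum>k\<in>UNIV. \<Sum>l\<in>UNIV. harmonic_quartic n $ i $ j $ k $ l * dyad_dev n $ k $ l) = (12/35) * (n$i * n$j) - (4/35) * mat 1$i$j" for i j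
  proof -
    have "(\<Sum>k\<in>UNIV. \<Sum>l\<in>UNIV. harmonic_quartic n $ i $ j $ k $ l * dyad_dev n $ k $ l) =
      (\<Sum>k\<in>UNIV. \<Sum>l\<in>UNIV. harmonic_quartic n $ i $ j $ k $ l * n $ k * n $ l)
      - (1/3) * (\<Sum>k\<in>UNIV. \<Sum>l\<in>UNIV. mat 1 $ k $ l * harmonic_quartic n $ i $ j $ k $ l)"
      by (simp add: dyad_dev_def dyad_def right_diff_distrib sum_subtractf sum_divide_distrib ac_simps)
    then show ?thesis unfolding kron_contract harmonic_quartic_trace[OF n] harmonic_quartic_contract2[OF n] by simp
  qed
  have "contract (dyad_dev n) (harmonic_quartic n) (dyad_dev n) =
      (\<Sum>i\<in>UNIV. \<Sum>j\<in>UNIV. dyad_dev n $ i $ j * (\<Sum>k\<in>UNIV. \<Sum>l\<in>UNIV. harmonic_quartic n $ i $ j $ k $ l * dyad_dev n $ k $ l))"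
    by (simp add: contract_def sum_distrib_left mult.assoc)
  also have "\<dots> = ((-(4/35)) *\<^sub>R mat 1 + (12/35) *\<^sub>R dyad n) \<bullet> dyad_dev n"
    unfolding M by (simp add: inner_vec_def dyad_def algebra_simps)
  also have "\<dots> = 8/35" unfolding inner_dyad_dev[OF n] by simp
  finally show ?thesis .
qed

lemma contract_scaleR: "contract (x *\<^sub>R a) (y *\<^sub>R H) (z *\<^sub>R b) = x * y * z * contract a H b"
  by (simp add: contract_def sum_distrib_left ac_simps)

lemma kappa_ti_tensor:
  assumes n: "norm n = 1" and nd: "nondegenerate c3 c4 c5"
  shows "\<kappa>\<^sub>1 (ti_tensor c1 c2 c3 c4 c5 n) = 9*c1 + 6*c2 + 6*c3 + 4*c4 + c5"
    and "\<kappa>\<^sub>2 (ti_tensor c1 c2 c3 c4 c5 n) = 3*c1 + 12*c2 + 2*c3 + 8*c4 + c5"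
    and "\<kappa>\<^sub>3 (ti_tensor c1 c2 c3 c4 c5 n) = 2/3 * (3*c3 + 4*c4 + c5)"
    and "\<kappa>\<^sub>4 (ti_tensor c1 c2 c3 c4 c5 n) = 2/3 * (2*c3 + 5*c4 + c5)"
    and "\<kappa>\<^sub>5 (ti_tensor c1 c2 c3 c4 c5 n) = 8/35 * c5"
proof -
  show "\<kappa>\<^sub>1 (ti_tensor c1 c2 c3 c4 c5 n) = 9*c1 + 6*c2 + 6*c3 + 4*c4 + c5"
    and "\<kappa>\<^sub>2 (ti_tensor c1 c2 c3 c4 c5 n) = 3*c1 + 12*c2 + 2*c3 + 8*c4 + c5"
    by (simp_all add: \<kappa>\<^sub>1_def \<kappa>\<^sub>2_def d_ti_tensor[OF n] v_ti_tensor[OF n] trace_add trace_scaleR trace_mat_1 trace_dyad[OF n])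
  show "\<kappa>\<^sub>3 (ti_tensor c1 c2 c3 c4 c5 n) = 2/3 * (3*c3 + 4*c4 + c5)"
    and "\<kappa>\<^sub>4 (ti_tensor c1 c2 c3 c4 c5 n) = 2/3 * (2*c3 + 5*c4 + c5)"
    unfolding \<kappa>\<^sub>3_def \<kappa>\<^sub>4_def t_ti_tensor(2)[OF n nd] d_ti_tensor[OF n] v_ti_tensor[OF n] inner_dyad_dev[OF n] by (rule refl)+
  show "\<kappa>\<^sub>5 (ti_tensor c1 c2 c3 c4 c5 n) = 8/35 * c5"
    using contract_scaleR[of 1 "dyad_dev n" c5 "harmonic_quartic n" 1 "dyad_dev n"]
    by (simp add: \<kappa>\<^sub>5_def t_ti_tensor(2)[OF n nd] H_ti_tensor[OF n] contract_harmonic_quartic[OF n])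
qed

section \<open>The rotation group and its subgroup O(2)\<close>

abbreviation e3 :: "real^3" where "e3 \<equiv> axis 3 1"

lemma carrier_SO3 [simp]: "carrier SO3 = {g. rotation_matrix g}"
  and mult_SO3 [simp]: "g \<otimes>\<^bsub>SO3\<^esub> h = g ** h"
  and one_SO3 [simp]: "\<one>\<^bsub>SO3\<^esub> = mat 1"
  by (simp_all add: SO3_def)

lemma rotation_matrix_mult: "rotation_matrix (g :: real^'n^'n) \<Longrightarrow> rotation_matrix h \<Longrightarrow> rotation_matrix (g ** h)"
  by (auto simp: rotation_matrix_def det_mul intro: orthogonal_matrix_mul)

lemma rotation_matrix_transpose: "rotation_matrix (g :: real^'n^'n) \<Longrightarrow> rotation_matrix (transpose g)"
  by (simp add: rotation_matrix_def det_transpose)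

lemma rotation_matrix_one: "rotation_matrix (mat 1)"
  by (simp add: rotation_matrix_def orthogonal_matrix_id)

lemma rotation_inverse:
  assumes "rotation_matrix (g :: real^'n^'n)"
  shows "transpose g ** g = mat 1" "g ** transpose g = mat 1"
  using assms by (auto simp: rotation_matrix_def orthogonal_matrix_def)

lemma group_SO3: "group SO3"
proof (rule groupI)
  show "\<exists>y\<in>carrier SO3. y \<otimes>\<^bsub>SO3\<^esub> x = \<one>\<^bsub>SO3\<^esub>" if "x \<in> carrier SO3" for x
    using that rotation_matrix_transpose rotation_inverse(1) by (intro bexI[of _ "transpose x"]) auto
qed (auto simp: rotation_matrix_mult rotation_matrix_one matrix_mul_assoc)

lemma inv_SO3:
  assumes "rotation_matrix g" shows "inv\<^bsub>SO3\<^esub> g = transpose g"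
  using assms rotation_matrix_transpose rotation_inverse
  by (intro group.inv_equality[OF group_SO3]) auto

lemma rotation_isometry:
  assumes "rotation_matrix (g :: real^'n^'n)" shows "norm (g *v x) = norm x"
proof (rule orthogonal_transformation_norm)
  show "orthogonal_transformation ((*v) g)"
    using assms by (simp add: orthogonal_transformation_matrix rotation_matrix_def)
qed

lemma rotation_transitive:
  fixes m n :: "real^3" assumes "norm n = norm m"
  obtains g where "rotation_matrix g" "g *v n = m"
proof -
  obtain f where "orthogonal_transformation f" "det (matrix f) = 1" "f n = m"
    using rotation_exists[OF _ assms] by auto
  then have "rotation_matrix (matrix f)" "matrix f *v n = m"
    by (auto simp: rotation_matrix_def orthogonal_transformation_matrix)
  then show ?thesis using that by blast
qed

lemma rotation_matrix_rot_e3: "rotation_matrix (rot_e3 \<theta>)"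
  by (simp add: rotation_matrix_def orthogonal_matrix rot_e3_def det_3 vec_eq_iff forall_3
      matrix_matrix_mult_def transpose_def sum_3 kron_components flip: power2_eq_square)

lemma rotation_matrix_rot_e1_pi: "rotation_matrix rot_e1_pi"
  by (simp add: rotation_matrix_def orthogonal_matrix rot_e1_pi_def det_3 vec_eq_iff forall_3
      matrix_matrix_mult_def transpose_def sum_3 kron_components)

lemma rot_e3_axis: "rot_e3 \<theta> *v e3 = e3"
  by (simp add: vec_eq_iff forall_3 matrix_vector_mult_def sum_3 rot_e3_def axis_def)

lemma rot_e1_pi_axis: "rot_e1_pi *v e3 = - e3"
  by (simp add: vec_eq_iff forall_3 matrix_vector_mult_def sum_3 rot_e1_pi_def axis_def)

lemma rot_e1_pi_involution: "rot_e1_pi ** rot_e1_pi = mat 1"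
  by (simp add: vec_eq_iff forall_3 matrix_matrix_mult_def sum_3 rot_e1_pi_def kron_components)

lemma rotation_fixing_e3:
  assumes g: "rotation_matrix g" and fix_e3: "g *v e3 = e3"
  obtains \<theta> where "g = rot_e3 \<theta>"
proof -
  have col: "g$1$3 = 0" "g$2$3 = 0" "g$3$3 = 1"
    using fix_e3 by (simp_all add: vec_eq_iff forall_3 matrix_vector_mult_def sum_3 axis_def)
  have "transpose g *v e3 = transpose g *v (g *v e3)" by (simp add: fix_e3)
  also have "\<dots> = e3" by (simp add: matrix_vector_mul_assoc rotation_inverse[OF g])
  finally have row: "g$3$1 = 0" "g$3$2 = 0"
    by (simp_all add: vec_eq_iff forall_3 matrix_vector_mult_def sum_3 axis_def transpose_def)
  have tg: "(transpose g ** g)$1$1 = 1" "(transpose g ** g)$1$2 = 0" "(transpose g ** g)$2$2 = 1"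
    by (simp_all add: rotation_inverse[OF g] kron_components)
  have o: "g$1$1 * g$1$1 + g$2$1 * g$2$1 = 1" "g$1$1 * g$1$2 + g$2$1 * g$2$2 = 0"
      "g$1$2 * g$1$2 + g$2$2 * g$2$2 = 1"
    using tg by (simp_all add: matrix_matrix_mult_def transpose_def sum_3 row)
  have d: "g$1$1 * g$2$2 - g$1$2 * g$2$1 = 1"
    using g by (simp add: rotation_matrix_def det_3 row col)
  have blk: "g$2$2 = g$1$1" "g$1$2 = - g$2$1"
    using o d by algebra+
  obtain \<theta> where "g$1$1 = cos \<theta>" "g$2$1 = sin \<theta>"
    using sincos_total_2pi[of "g$1$1" "g$2$1"] o(1) by (auto simp: power2_eq_square)
  then have "g = rot_e3 \<theta>"
    by (simp add: vec_eq_iff forall_3 rot_e3_def row col blk)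
  then show ?thesis using that by blast
qed

lemma O2_eq: "O2 = {g. rotation_matrix g \<and> (g *v e3 = e3 \<or> g *v e3 = - e3)}" (is "_ = ?S")
proof
  have neg: "g *v (- x) = - (g *v x)" for g :: tensor2 and x
    by (metis matrix_vector_mul_linear linear_neg)
  have inv_S: "transpose h \<in> ?S" if "h \<in> ?S" for h
  proof -
    have h: "rotation_matrix h" "h *v e3 = e3 \<or> h *v e3 = - e3" using that by auto
    have "transpose h *v (h *v e3) = e3"
      by (simp add: matrix_vector_mul_assoc rotation_inverse[OF h(1)])
    then have "transpose h *v e3 = e3 \<or> transpose h *v e3 = - e3"
      using h(2) by (metis neg minus_minus)
    then show ?thesis using rotation_matrix_transpose[OF h(1)] by simp
  qed
  have gens: "insert rot_e1_pi (range rot_e3) \<subseteq> ?S"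
    by (auto simp: rotation_matrix_rot_e3 rotation_matrix_rot_e1_pi rot_e3_axis rot_e1_pi_axis)
  show "O2 \<subseteq> ?S"
  proof
    fix g assume "g \<in> O2"
    then show "g \<in> ?S" unfolding O2_def
    proof (induction rule: generate.induct)
      case one
      then show ?case by (simp add: rotation_matrix_one)
    next
      case (incl h)
      then show ?case using gens by blast
    next
      case (inv h)
      then have "h \<in> ?S" using gens by blast
      then show ?case using inv_S inv_SO3 by auto
    next
      case (eng h1 h2)
      then show ?case by (auto simp: rotation_matrix_mult neg simp flip: matrix_vector_mul_assoc)
    qed
  qed
  show "?S \<subseteq> O2"
  proof
    fix g assume "g \<in> ?S"
    then have g: "rotation_matrix g" by simp
    consider "g *v e3 = e3" | "g *v e3 = - e3" using \<open>g \<in> ?S\<close> by auto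
    then show "g \<in> O2"
    proof cases
      case 1
      then show ?thesis using rotation_fixing_e3[OF g] unfolding O2_def
        by (metis generate.incl insertCI rangeI)
    next
      case 2
      \<comment> \<open>Composition with the half-turn about \<open>e1\<close> reduces this case to the previous one.\<close>
      have "(g ** rot_e1_pi) *v e3 = e3"
        by (simp add: rot_e1_pi_axis neg 2 flip: matrix_vector_mul_assoc)
      then obtain \<theta> where "g ** rot_e1_pi = rot_e3 \<theta>"
        using rotation_fixing_e3 rotation_matrix_mult[OF g rotation_matrix_rot_e1_pi] by metis
      then have "g = rot_e3 \<theta> \<otimes>\<^bsub>SO3\<^esub> rot_e1_pi"
        by (metis matrix_mul_assoc matrix_mul_rid mult_SO3 rot_e1_pi_involution)
      then show ?thesis unfolding O2_def
        by (metis generate.eng generate.incl insertCI rangeI)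
    qed
  qed
qed

text \<open>The conjugate of \<open>O2\<close> by \<open>g\<close> is the group of rotations that preserve the line spanned by
  \<open>g *v e3\<close>.\<close>

lemma conjugate_O2:
  assumes g: "rotation_matrix g"
  shows "(g <#\<^bsub>SO3\<^esub> O2) #>\<^bsub>SO3\<^esub> inv\<^bsub>SO3\<^esub> g
    = {k. rotation_matrix k \<and> (k *v (g *v e3) = g *v e3 \<or> k *v (g *v e3) = - (g *v e3))}" (is "?L = ?R")
proof -
  have neg: "g *v (- x) = - (g *v x)" for g :: tensor2 and x
    by (metis matrix_vector_mul_linear linear_neg)
  have L: "?L = {g ** h ** transpose g | h. h \<in> O2}"
    by (auto simp: l_coset_def r_coset_def inv_SO3[OF g])
  show ?thesis
  proof (intro equalityI subsetI)
    fix k assume "k \<in> ?L"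
    then obtain h where h: "h \<in> O2" "k = g ** h ** transpose g" using L by auto
    have "k *v (g *v e3) = g *v (h *v ((transpose g ** g) *v e3))"
      by (simp add: h(2) matrix_vector_mul_assoc matrix_mul_assoc)
    then have "k *v (g *v e3) = g *v (h *v e3)" by (simp add: rotation_inverse[OF g])
    then show "k \<in> ?R"
      using h g by (auto simp: O2_eq neg rotation_matrix_mult rotation_matrix_transpose)
  next
    fix k assume k: "k \<in> ?R"
    define h where "h = transpose g ** k ** g"
    have "h *v e3 = transpose g *v (k *v (g *v e3))"
      by (simp add: h_def matrix_vector_mul_assoc matrix_mul_assoc)
    moreover have "transpose g *v (g *v e3) = e3"
      by (simp add: matrix_vector_mul_assoc rotation_inverse[OF g])
    ultimately have "h *v e3 = e3 \<or> h *v e3 = - e3" using k neg[of "transpose g" "g *v e3"] by auto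
    then have "h \<in> O2"
      using k g by (simp add: O2_eq h_def rotation_matrix_mult rotation_matrix_transpose)
    moreover have "k = g ** h ** transpose g"
      unfolding h_def by (metis g matrix_mul_assoc matrix_mul_lid matrix_mul_rid rotation_inverse(2))
    ultimately show "k \<in> ?L" using L by auto
  qed
qed

section \<open>The transversely isotropic stratum\<close>

text \<open>The half-turns about \<open>e3\<close> and \<open>e1\<close> remove the components in which some index
  value occurs an odd number of times, the quarter-turn about \<open>e3\<close> identifies the indices 1 and 2,
  and one further rotation about \<open>e3\<close> gives the remaining relation between the components in
  the plane orthogonal to \<open>e3\<close>.\<close>

lemma O2_fixed_normal_form:
  assumes "E \<in> Ela" and fixed: "\<And>k. k \<in> O2 \<Longrightarrow> act4 k E = E"
  obtains c1 c2 c3 c4 c5 where "E = ti_tensor c1 c2 c3 c4 c5 e3"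
proof -
  have rot: "act4 (rot_e3 \<theta>) E = E" for \<theta>
    by (intro fixed) (simp add: O2_eq rotation_matrix_rot_e3 rot_e3_axis)
  have flip: "act4 rot_e1_pi E = E"
    by (intro fixed) (simp add: O2_eq rotation_matrix_rot_e1_pi rot_e1_pi_axis)
  have major: "E$i$j$k$l = E$k$l$i$j" and minor: "E$i$j$k$l = E$j$i$k$l" for i j k l
    using assms(1) by (auto simp: Ela_def)
  have sorted_minor: "E$2$1$k$l = E$1$2$k$l" "E$3$1$k$l = E$1$3$k$l" "E$3$2$k$l = E$2$3$k$l"
    "E$k$l$2$1 = E$k$l$1$2" "E$k$l$3$1 = E$k$l$1$3" "E$k$l$3$2 = E$k$l$2$3" for k l
    using major minor by metis+
  have sorted_major: "E$2$2$1$1 = E$1$1$2$2" "E$3$3$1$1 = E$1$1$3$3" "E$3$3$2$2 = E$2$2$3$3"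
    "E$2$3$k$k = E$k$k$2$3" "E$1$3$k$k = E$k$k$1$3" "E$1$2$k$k = E$k$k$1$2"
    "E$1$3$2$3 = E$2$3$1$3" "E$1$2$2$3 = E$2$3$1$2" "E$1$2$1$3 = E$1$3$1$2" for k
    using major by metis+
  note symm = sorted_minor sorted_major
  have half_turn: "E$k$k$2$3 = 0" "E$k$k$1$3 = 0" "E$2$3$1$2 = 0" "E$1$3$1$2 = 0" for k
  proof -
    have *: "act4 (rot_e3 pi) E $ i $ j $ k $ l = E $ i $ j $ k $ l" for i j k l by (simp add: rot)
    have "\<forall>k. E$k$k$2$3 = 0" "\<forall>k. E$k$k$1$3 = 0"
      unfolding forall_3 using *[of 1 1 2 3] *[of 2 2 2 3] *[of 3 3 2 3] *[of 1 1 1 3] *[of 2 2 1 3] *[of 3 3 1 3]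
      by (simp_all add: act4_nth sum_3 rot_e3_def)
    then show "E$k$k$2$3 = 0" "E$k$k$1$3 = 0" by auto
    show "E$2$3$1$2 = 0" "E$1$3$1$2 = 0"
      using *[of 2 3 1 2] *[of 1 3 1 2] by (simp_all add: act4_nth sum_3 rot_e3_def)
  qed
  have flipped: "E$k$k$1$2 = 0" "E$2$3$1$3 = 0" for k
  proof -
    have *: "act4 rot_e1_pi E $ i $ j $ k $ l = E $ i $ j $ k $ l" for i j k l by (simp add: flip)
    have "\<forall>k. E$k$k$1$2 = 0"
      unfolding forall_3 using *[of 1 1 1 2] *[of 2 2 1 2] *[of 3 3 1 2]
      by (simp_all add: act4_nth sum_3 rot_e1_pi_def)
    then show "E$k$k$1$2 = 0" by auto
    show "E$2$3$1$3 = 0"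
      using *[of 2 3 1 3] by (simp add: act4_nth sum_3 rot_e1_pi_def)
  qed
  have quarter_turn: "E$2$2$2$2 = E$1$1$1$1" "E$2$2$3$3 = E$1$1$3$3" "E$2$3$2$3 = E$1$3$1$3"
  proof -
    have *: "act4 (rot_e3 (pi/2)) E $ i $ j $ k $ l = E $ i $ j $ k $ l" for i j k l by (simp add: rot)
    show "E$2$2$2$2 = E$1$1$1$1" "E$2$2$3$3 = E$1$1$3$3" "E$2$3$2$3 = E$1$3$1$3"
      using *[of 1 1 1 1] *[of 1 1 3 3] *[of 1 3 1 3] by (simp_all add: act4_nth sum_3 rot_e3_def)
  qed
  have in_plane: "E$1$1$1$1 = E$1$1$2$2 + 2 * E$1$2$1$2"
  proof -
    \<comment> \<open>Any angle that is not a multiple of \<open>pi/2\<close> would do; this one has rational sine and cosine.\<close>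
    obtain \<theta> :: real where \<theta>: "3/5 = cos \<theta>" "4/5 = sin \<theta>"
      using sincos_total_2pi[of "3/5" "4/5"] by (auto simp: power2_eq_square)
    have "act4 (rot_e3 \<theta>) E $ 1 $ 1 $ 1 $ 1 = E $ 1 $ 1 $ 1 $ 1" by (simp add: rot)
    then show ?thesis
      by (simp add: act4_nth sum_3 rot_e3_def symm flipped half_turn quarter_turn flip: \<theta>)
  qed
  have "E = ti_tensor (E$1$1$2$2) (E$1$2$1$2) (E$1$1$3$3 - E$1$1$2$2) (E$1$3$1$3 - E$1$2$1$2)
     (E$3$3$3$3 + E$1$1$2$2 + 2 * E$1$2$1$2 - 2 * E$1$1$3$3 - 4 * E$1$3$1$3) e3"
    unfolding vec_eq_iff forall_3 ti_tensor_nth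
    by (simp add: kron_components axis_def symm half_turn flipped quarter_turn in_plane)
  then show ?thesis using that by blast
qed

lemma dyad_eq_iff: "dyad m = dyad n \<longleftrightarrow> m = n \<or> m = - n"
proof
  assume "dyad m = dyad n"
  then have e: "m$i * m$j = n$i * n$j" for i j by (simp add: dyad_def vec_eq_iff)
  show "m = n \<or> m = - n"
  proof (cases "n = 0")
    case True
    then have "m$i = 0" for i using e[of i i] by simp
    then show ?thesis using True by (simp add: vec_eq_iff)
  next
    case False
    then obtain k where k: "n$k \<noteq> 0" by (auto simp: vec_eq_iff)
    have "m$k = n$k \<or> m$k = - n$k" using e[of k k] by (simp add: square_eq_iff)
    then show ?thesis
    proof
      assume "m$k = n$k"
      then have "m$i = n$i" for i using e[of i k] k by simp
      then show ?thesis by (simp add: vec_eq_iff)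
    next
      assume *: "m$k = - n$k"
      have "(m$i + n$i) * n$k = 0" for i using e[of i k] * by (simp add: algebra_simps)
      then have "m$i = - n$i" for i using k by (simp add: eq_neg_iff_add_eq_0)
      then show ?thesis by (simp add: vec_eq_iff)
    qed
  qed
next
  assume "m = n \<or> m = - n"
  then show "dyad m = dyad n" by (auto simp: dyad_def)
qed

lemma stabilizer_ti_tensor:
  assumes n: "norm n = 1" and nd: "nondegenerate c3 c4 c5"
  shows "stabilizer SO3 act4 (ti_tensor c1 c2 c3 c4 c5 n) = {k. rotation_matrix k \<and> (k *v n = n \<or> k *v n = - n)}"
proof -
  have "act4 k (ti_tensor c1 c2 c3 c4 c5 n) = ti_tensor c1 c2 c3 c4 c5 n \<longleftrightarrow> k *v n = n \<or> k *v n = - n"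
    if k: "rotation_matrix k" for k
  proof -
    have a: "act4 k (ti_tensor c1 c2 c3 c4 c5 n) = ti_tensor c1 c2 c3 c4 c5 (k *v n)"
      using k by (simp add: act4_ti_tensor rotation_matrix_def)
    have "dyad (k *v n) = dyad n" if "ti_tensor c1 c2 c3 c4 c5 (k *v n) = ti_tensor c1 c2 c3 c4 c5 n"
    proof -
      have "norm (k *v n) = 1" using rotation_isometry[OF k] n by simp
      then have "dyad_dev (k *v n) = dyad_dev n" using that t_ti_tensor(2) n nd by metis
      then show ?thesis by (simp add: dyad_dev_def)
    qed
    moreover have "ti_tensor c1 c2 c3 c4 c5 (k *v n) = ti_tensor c1 c2 c3 c4 c5 n" if "dyad (k *v n) = dyad n"
      by (simp add: ti_tensor_def that)
    ultimately show ?thesis using a dyad_eq_iff by metis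
  qed
  then show ?thesis by (auto simp: stabilizer_def)
qed

lemma act4_isotropic:
  assumes "\<not> nondegenerate c3 c4 c5" and k: "rotation_matrix k"
  shows "act4 k (ti_tensor c1 c2 c3 c4 c5 n) = ti_tensor c1 c2 c3 c4 c5 n"
proof -
  have "c3 = 0" "c4 = 0" "c5 = 0" using assms(1) by (auto simp: nondegenerate_def)
  then show ?thesis using k by (simp add: act4_ti_tensor rotation_matrix_def) (simp add: ti_tensor_def)
qed

lemma stratum_O2:
  "stratum O2 = {ti_tensor c1 c2 c3 c4 c5 n | c1 c2 c3 c4 c5 n. norm n = 1 \<and> nondegenerate c3 c4 c5}"
proof (intro equalityI subsetI)
  fix E assume "E \<in> stratum O2"
  then obtain g where E: "E \<in> Ela" and g: "rotation_matrix g"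
    and stab: "stabilizer SO3 act4 E = {k. rotation_matrix k \<and> (k *v (g *v e3) = g *v e3 \<or> k *v (g *v e3) = - (g *v e3))}"
    by (auto simp: stratum_def conjugate_O2)
  let ?n = "g *v e3"
  have n: "norm ?n = 1" using rotation_isometry[OF g] by simp
  have unrotate: "act4 g (act4 (transpose g) E) = E"
    by (simp add: act4_one rotation_inverse[OF g] flip: act4_mult)
  have "act4 h (act4 (transpose g) E) = act4 (transpose g) E" if "h \<in> O2" for h
  proof -
    have "g ** h ** transpose g \<in> (g <#\<^bsub>SO3\<^esub> O2) #>\<^bsub>SO3\<^esub> inv\<^bsub>SO3\<^esub> g"
      using that by (auto simp: l_coset_def r_coset_def inv_SO3[OF g])
    then have "act4 (g ** h ** transpose g) E = E"
      using stab unfolding conjugate_O2[OF g] stabilizer_def by auto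
    then have "act4 (transpose g ** (g ** h ** transpose g)) E = act4 (transpose g) E"
      by (simp add: act4_mult)
    moreover have "transpose g ** (g ** h ** transpose g) = h ** transpose g"
      by (simp add: matrix_mul_assoc rotation_inverse[OF g])
    ultimately show ?thesis by (simp add: act4_mult)
  qed
  then obtain c1 c2 c3 c4 c5 where "act4 (transpose g) E = ti_tensor c1 c2 c3 c4 c5 e3"
    using O2_fixed_normal_form act4_Ela[OF E] by metis
  then have E_eq: "E = ti_tensor c1 c2 c3 c4 c5 ?n"
    using unrotate act4_ti_tensor g by (metis rotation_matrix_def)
  have "nondegenerate c3 c4 c5"
  proof (rule ccontr)
    assume nd: "\<not> nondegenerate c3 c4 c5"
    \<comment> \<open>An isotropic tensor is also fixed by rotations that move the line spanned by \<open>?n\<close>.\<close>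
    obtain m :: "real^3" where m: "norm m = 1" "m \<noteq> ?n" "m \<noteq> - ?n"
    proof (cases "axis 1 1 = ?n \<or> axis 1 1 = - ?n")
      case True
      have "axis 2 1 \<noteq> (axis 1 1 :: real^3)" "axis 2 1 \<noteq> - (axis 1 1 :: real^3)"
        by (auto simp: axis_def vec_eq_iff)
      then show ?thesis using True by (intro that[of "axis 2 1"]) auto
    next
      case False
      then show ?thesis by (intro that[of "axis 1 1"]) auto
    qed
    obtain k where k: "rotation_matrix k" "k *v ?n = m"
      using rotation_transitive n m(1) by metis
    then have "k \<in> stabilizer SO3 act4 E"
      using act4_isotropic[OF nd] by (simp add: stabilizer_def E_eq)
    then show False using stab k m by auto
  qed
  then show "E \<in> {ti_tensor c1 c2 c3 c4 c5 n | c1 c2 c3 c4 c5 n. norm n = 1 \<and> nondegenerate c3 c4 c5}"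
    using E_eq n by blast
next
  fix E assume "E \<in> {ti_tensor c1 c2 c3 c4 c5 n | c1 c2 c3 c4 c5 n. norm n = 1 \<and> nondegenerate c3 c4 c5}"
  then obtain c1 c2 c3 c4 c5 n where E: "E = ti_tensor c1 c2 c3 c4 c5 n" and n: "norm n = 1" and nd: "nondegenerate c3 c4 c5"
    by blast
  obtain g where g: "rotation_matrix g" "g *v e3 = n"
    using rotation_transitive[of e3 n] n by auto
  have "stabilizer SO3 act4 E = (g <#\<^bsub>SO3\<^esub> O2) #>\<^bsub>SO3\<^esub> inv\<^bsub>SO3\<^esub> g"
    unfolding conjugate_O2[OF g(1)] E stabilizer_ti_tensor[OF n nd] g(2) ..
  then show "E \<in> stratum O2" using g(1) by (auto simp: stratum_def E ti_tensor_in_Ela)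
qed

section \<open>Rationality of the invariants\<close>

lemmas real_poly_linear = real_polynomial_function.intros(1)
  and real_poly_const = real_polynomial_function.intros(2)
  and real_poly_add = real_polynomial_function.intros(3)
  and real_poly_mult = real_polynomial_function.intros(4)

lemma poly_nth4: "real_polynomial_function (\<lambda>E::tensor4. E$i$j$k$l)"
  by (intro real_poly_linear bounded_linear_compose[OF bounded_linear_vec_nth] bounded_linear_vec_nth)

text \<open>Second-order tensors whose components are polynomial functions of the elasticity tensor.\<close>

definition polynomial_tensor2 :: "(tensor4 \<Rightarrow> tensor2) \<Rightarrow> bool" where
  "polynomial_tensor2 A \<longleftrightarrow> (\<forall>i j. real_polynomial_function (\<lambda>E. A E $ i $ j))"

lemma polynomial_tensor2_add: "polynomial_tensor2 A \<Longrightarrow> polynomial_tensor2 A' \<Longrightarrow> polynomial_tensor2 (\<lambda>E. A E + A' E)"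
  by (auto simp: polynomial_tensor2_def)

lemma polynomial_tensor2_scale: "real_polynomial_function f \<Longrightarrow> polynomial_tensor2 A \<Longrightarrow> polynomial_tensor2 (\<lambda>E. f E *\<^sub>R A E)"
  by (auto simp: polynomial_tensor2_def)

lemma polynomial_tensor2_mult: "polynomial_tensor2 A \<Longrightarrow> polynomial_tensor2 A' \<Longrightarrow> polynomial_tensor2 (\<lambda>E. A E ** A' E)"
  by (auto simp: polynomial_tensor2_def matrix_matrix_mult_def intro!: real_polynomial_function_sum real_poly_mult)

lemma poly_trace: "polynomial_tensor2 A \<Longrightarrow> real_polynomial_function (\<lambda>E. trace (A E))"
  by (auto simp: polynomial_tensor2_def trace_def)

lemma poly_inner: "polynomial_tensor2 A \<Longrightarrow> polynomial_tensor2 A' \<Longrightarrow> real_polynomial_function (\<lambda>E. A E \<bullet> A' E)"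
  by (auto simp: polynomial_tensor2_def inner_vec_def intro!: real_polynomial_function_sum real_poly_mult)

lemma poly_norm2: "polynomial_tensor2 A \<Longrightarrow> real_polynomial_function (\<lambda>E. (norm (A E))\<^sup>2)"
  using poly_inner[of A A] by (simp add: power2_norm_eq_inner)

lemma poly_norm4: "polynomial_tensor2 A \<Longrightarrow> real_polynomial_function (\<lambda>E. norm (A E) ^ 4)"
  using real_polynomial_function_power[OF poly_norm2, of A 2] by simp

lemma polynomial_tensor2_dev:
  assumes "polynomial_tensor2 A" shows "polynomial_tensor2 (\<lambda>E. dev (A E))"
proof -
  have "real_polynomial_function (\<lambda>E. A E $ i $ j - 1/3 * trace (A E) * mat 1 $ i $ j)" for i j
    using assms poly_trace[OF assms] unfolding polynomial_tensor2_def
    by (intro real_polynomial_function_diff real_poly_mult real_poly_const) auto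
  then show ?thesis by (simp add: polynomial_tensor2_def dev_def)
qed

lemma polynomial_tensor2_d: "polynomial_tensor2 d_tens" and polynomial_tensor2_v: "polynomial_tensor2 v_tens"
  by (auto simp: polynomial_tensor2_def d_tens_def v_tens_def intro!: poly_nth4)

lemma poly_tsym: "real_polynomial_function (\<lambda>E. tsym E $ i $ j $ k $ l)"
  unfolding tsym_def Let_def
  by (auto simp: finite_permutations intro!: poly_nth4 real_polynomial_function_sum real_poly_mult)

lemma poly_sym_prod:
  assumes "polynomial_tensor2 A" shows "real_polynomial_function (\<lambda>E. sym_prod (mat 1) (A E) $ i $ j $ k $ l)"
  using assms unfolding sym_prod_def tsym_def tensor_prod_def polynomial_tensor2_def Let_def
  by (auto simp: finite_permutations intro!: real_polynomial_function_sum real_poly_mult)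

lemma poly_H: "real_polynomial_function (\<lambda>E. H_tens E $ i $ j $ k $ l)"
proof -
  have a: "polynomial_tensor2 a_tens"
    unfolding a_tens_def by (intro polynomial_tensor2_scale polynomial_tensor2_add polynomial_tensor2_d polynomial_tensor2_v real_poly_const)
  show ?thesis
    unfolding H_tens_def vector_minus_component vector_scaleR_component real_scaleR_def
    by (intro real_poly_const real_polynomial_function_diff real_poly_mult
        poly_tsym poly_sym_prod polynomial_tensor2_dev poly_trace a)
qed

lemma polynomial_tensor2_d2: "polynomial_tensor2 d2_tens"
  by (auto simp: polynomial_tensor2_def d2_tens_def intro!: real_polynomial_function_sum real_poly_mult poly_H)

lemma poly_contract_H: "polynomial_tensor2 A \<Longrightarrow> real_polynomial_function (\<lambda>E. contract (A E) (H_tens E) (A E))"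
  unfolding contract_def polynomial_tensor2_def
  by (intro real_polynomial_function_sum real_poly_mult poly_H) auto

lemma poly_t_denominator: "real_polynomial_function t_denominator"
  unfolding t_denominator_def
  by (intro real_poly_add poly_norm4 poly_norm2 polynomial_tensor2_dev polynomial_tensor2_d polynomial_tensor2_v polynomial_tensor2_d2)

lemma polynomial_tensor2_t_numerator: "polynomial_tensor2 t_numerator"
  unfolding t_numerator_def
  by (intro polynomial_tensor2_dev polynomial_tensor2_add polynomial_tensor2_scale polynomial_tensor2_mult poly_norm2 polynomial_tensor2_d polynomial_tensor2_v polynomial_tensor2_d2)

lemma rational_kappa:
  shows "rational_on (stratum O2) \<kappa>\<^sub>1" "rational_on (stratum O2) \<kappa>\<^sub>2" "rational_on (stratum O2) \<kappa>\<^sub>3"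
    "rational_on (stratum O2) \<kappa>\<^sub>4" "rational_on (stratum O2) \<kappa>\<^sub>5"
proof -
  let ?X = "stratum O2"
  have nz: "t_denominator E \<noteq> 0" if "E \<in> ?X" for E
    using that t_ti_tensor(1) unfolding stratum_O2 by blast
  have poly: "rational_on ?X p" if "real_polynomial_function p" for p
    unfolding rational_on_def using that real_poly_const[of 1] by (intro exI[of _ p] exI[of _ "\<lambda>_. 1"]) auto
  show "rational_on ?X \<kappa>\<^sub>1" "rational_on ?X \<kappa>\<^sub>2"
    unfolding \<kappa>\<^sub>1_def \<kappa>\<^sub>2_def by (intro poly poly_trace polynomial_tensor2_d polynomial_tensor2_v)+
  have quot: "rational_on ?X f"
    if "real_polynomial_function p" and "\<And>E. f E = p E / t_denominator E ^ m" for f p m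
    unfolding rational_on_def using that nz poly_t_denominator
    by (intro exI[of _ p] exI[of _ "\<lambda>E. t_denominator E ^ m"]) (auto intro: real_polynomial_function_power)
  show "rational_on ?X \<kappa>\<^sub>3"
    by (rule quot[of "\<lambda>E. 2 * (d_tens E \<bullet> t_numerator E)" _ 1])
      (auto simp: \<kappa>\<^sub>3_def t_tens_eq intro!: real_poly_mult real_poly_const poly_inner polynomial_tensor2_d polynomial_tensor2_t_numerator)
  show "rational_on ?X \<kappa>\<^sub>4"
    by (rule quot[of "\<lambda>E. 2 * (v_tens E \<bullet> t_numerator E)" _ 1])
      (auto simp: \<kappa>\<^sub>4_def t_tens_eq intro!: real_poly_mult real_poly_const poly_inner polynomial_tensor2_v polynomial_tensor2_t_numerator)
  show "rational_on ?X \<kappa>\<^sub>5"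
  proof (rule quot[of "\<lambda>E. 4 * contract (t_numerator E) (H_tens E) (t_numerator E)" _ 2])
    show "real_polynomial_function (\<lambda>E. 4 * contract (t_numerator E) (H_tens E) (t_numerator E))"
      by (intro real_poly_mult real_poly_const poly_contract_H polynomial_tensor2_t_numerator)
    show "\<kappa>\<^sub>5 E = 4 * contract (t_numerator E) (H_tens E) (t_numerator E) / t_denominator E ^ 2" for E
      using contract_scaleR[of "2 / t_denominator E" "t_numerator E" 1 "H_tens E"]
      by (simp add: \<kappa>\<^sub>5_def t_tens_eq power2_eq_square)
  qed
qed

section \<open>Functional bases\<close>

text \<open>Invariants that separate orbits form a functional basis: an invariant function is
  determined at \<open>x\<close> by its value at any chosen point with the same tuple of invariants.\<close>

lemma functional_basisI:
  assumes stable: "\<And>g x. g \<in> carrier G \<Longrightarrow> x \<in> X \<Longrightarrow> act g x \<in> X"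
    and "finite \<Phi>" "\<Phi> \<subseteq> extensional X"
    and "\<And>\<phi>. \<phi> \<in> \<Phi> \<Longrightarrow> invariant_on G act X \<phi>"
    and separates: "\<And>x y. x \<in> X \<Longrightarrow> y \<in> X \<Longrightarrow> (\<And>\<phi>. \<phi> \<in> \<Phi> \<Longrightarrow> \<phi> x = \<phi> y) \<Longrightarrow> \<exists>g\<in>carrier G. act g x = y"
  shows "functional_basis G act X \<Phi>"
proof -
  have "\<exists>F. \<forall>x\<in>X. f x = F (\<lambda>\<phi>\<in>\<Phi>. \<phi> x)" if f: "invariant_on G act X f" for f
  proof -
    define F where "F t = f (SOME x. x \<in> X \<and> (\<lambda>\<phi>\<in>\<Phi>. \<phi> x) = t)" for t
    have "f x = F (\<lambda>\<phi>\<in>\<Phi>. \<phi> x)" if x: "x \<in> X" for x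
    proof -
      define y where "y = (SOME y. y \<in> X \<and> (\<lambda>\<phi>\<in>\<Phi>. \<phi> y) = (\<lambda>\<phi>\<in>\<Phi>. \<phi> x))"
      have y: "y \<in> X" "(\<lambda>\<phi>\<in>\<Phi>. \<phi> y) = (\<lambda>\<phi>\<in>\<Phi>. \<phi> x)"
        using someI[of "\<lambda>y. y \<in> X \<and> (\<lambda>\<phi>\<in>\<Phi>. \<phi> y) = (\<lambda>\<phi>\<in>\<Phi>. \<phi> x)" x] x by (auto simp: y_def)
      have "\<phi> x = \<phi> y" if "\<phi> \<in> \<Phi>" for \<phi>
        using fun_cong[OF y(2), of \<phi>] that by simp
      then obtain g where "g \<in> carrier G" "act g x = y" using separates x y(1) by blast
      then have "f y = f x" using f x by (auto simp: invariant_on_def)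
      then show ?thesis by (simp add: F_def y_def)
    qed
    then show ?thesis by blast
  qed
  then show ?thesis using assms by (auto simp: functional_basis_def)
qed

text \<open>If a member can change while the others keep their values, it is not a function of the
  others.\<close>

lemma minimal_functional_basisI:
  fixes act :: "'g \<Rightarrow> 'b \<Rightarrow> 'b"
  assumes basis: "functional_basis G act X \<Phi>"
    and independent: "\<And>\<phi>. \<phi> \<in> \<Phi> \<Longrightarrow> \<exists>x\<in>X. \<exists>y\<in>X. \<phi> x \<noteq> \<phi> y \<and> (\<forall>\<psi>\<in>\<Phi> - {\<phi>}. \<psi> x = \<psi> y)"
  shows "minimal_functional_basis G act X \<Phi>"
  unfolding minimal_functional_basis_def
proof (intro conjI basis allI impI notI)
  fix \<Psi> assume "\<Psi> \<subset> \<Phi>" and \<Psi>: "functional_basis G act X \<Psi>"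
  then obtain \<phi> where \<phi>: "\<phi> \<in> \<Phi>" "\<phi> \<notin> \<Psi>" by blast
  obtain x y where xy: "x \<in> X" "y \<in> X" "\<phi> x \<noteq> \<phi> y" "\<forall>\<psi>\<in>\<Phi> - {\<phi>}. \<psi> x = \<psi> y"
    using independent[OF \<phi>(1)] by blast
  have "invariant_on G act X \<phi>" using basis \<phi>(1) by (auto simp: functional_basis_def)
  then have "\<exists>F :: (('b \<Rightarrow> real) \<Rightarrow> real) \<Rightarrow> real. \<forall>x\<in>X. \<phi> x = F (\<lambda>\<psi>\<in>\<Psi>. \<psi> x)"
    using \<Psi> unfolding functional_basis_def by blast
  then obtain F :: "(('b \<Rightarrow> real) \<Rightarrow> real) \<Rightarrow> real" where F: "\<forall>x\<in>X. \<phi> x = F (\<lambda>\<psi>\<in>\<Psi>. \<psi> x)"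
    by blast
  have "(\<lambda>\<psi>\<in>\<Psi>. \<psi> x) = (\<lambda>\<psi>\<in>\<Psi>. \<psi> y)"
    using xy(4) \<open>\<Psi> \<subset> \<Phi>\<close> \<phi>(2) by (intro restrict_ext) auto
  then show False using F xy(1-3) by metis
qed

section \<open>Orbits and values of the invariants\<close>

lemma kappa_separates:
  assumes "E \<in> stratum O2" "E' \<in> stratum O2"
    and "\<kappa>\<^sub>1 E = \<kappa>\<^sub>1 E'" "\<kappa>\<^sub>2 E = \<kappa>\<^sub>2 E'" "\<kappa>\<^sub>3 E = \<kappa>\<^sub>3 E'" "\<kappa>\<^sub>4 E = \<kappa>\<^sub>4 E'" "\<kappa>\<^sub>5 E = \<kappa>\<^sub>5 E'"
  shows "\<exists>g. rotation_matrix g \<and> act4 g E = E'"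
proof -
  obtain c1 c2 c3 c4 c5 n where E: "E = ti_tensor c1 c2 c3 c4 c5 n" and n: "norm n = 1" and nd: "nondegenerate c3 c4 c5"
    using assms(1) unfolding stratum_O2 by blast
  obtain c1' c2' c3' c4' c5' n' where E': "E' = ti_tensor c1' c2' c3' c4' c5' n'" and n': "norm n' = 1" and nd': "nondegenerate c3' c4' c5'"
    using assms(2) unfolding stratum_O2 by blast
  note eqs = assms(3-7)[unfolded E E' kappa_ti_tensor[OF n nd] kappa_ti_tensor[OF n' nd']]
  have "c5 = c5'" using eqs(5) by simp
  moreover from this have "c3 = c3'" "c4 = c4'" using eqs(3,4) by simp_all
  moreover from calculation have "c1 = c1'" "c2 = c2'" using eqs(1,2) by simp_all
  moreover obtain g where "rotation_matrix g" "g *v n = n'" using rotation_transitive n n' by metis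
  ultimately show ?thesis by (auto simp: E E' act4_ti_tensor rotation_matrix_def)
qed

lemma kappa_invariant:
  assumes "E \<in> stratum O2" "rotation_matrix g"
  shows "act4 g E \<in> stratum O2"
    and "\<kappa>\<^sub>1 (act4 g E) = \<kappa>\<^sub>1 E" "\<kappa>\<^sub>2 (act4 g E) = \<kappa>\<^sub>2 E" "\<kappa>\<^sub>3 (act4 g E) = \<kappa>\<^sub>3 E"
      "\<kappa>\<^sub>4 (act4 g E) = \<kappa>\<^sub>4 E" "\<kappa>\<^sub>5 (act4 g E) = \<kappa>\<^sub>5 E"
proof -
  obtain c1 c2 c3 c4 c5 n where E: "E = ti_tensor c1 c2 c3 c4 c5 n" and n: "norm n = 1" and nd: "nondegenerate c3 c4 c5"
    using assms(1) unfolding stratum_O2 by blast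
  have gE: "act4 g E = ti_tensor c1 c2 c3 c4 c5 (g *v n)"
    using assms(2) by (simp add: E act4_ti_tensor rotation_matrix_def)
  have gn: "norm (g *v n) = 1" using rotation_isometry[OF assms(2)] n by simp
  show "act4 g E \<in> stratum O2" unfolding stratum_O2 gE using gn nd by blast
  show "\<kappa>\<^sub>1 (act4 g E) = \<kappa>\<^sub>1 E" "\<kappa>\<^sub>2 (act4 g E) = \<kappa>\<^sub>2 E" "\<kappa>\<^sub>3 (act4 g E) = \<kappa>\<^sub>3 E"
      "\<kappa>\<^sub>4 (act4 g E) = \<kappa>\<^sub>4 E" "\<kappa>\<^sub>5 (act4 g E) = \<kappa>\<^sub>5 E"
    unfolding gE unfolding E kappa_ti_tensor[OF gn nd] kappa_ti_tensor[OF n nd] by (rule refl)+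
qed

lemma kappa_attains:
  assumes "x3 \<noteq> 0 \<or> x4 \<noteq> 0 \<or> x5 \<noteq> 0"
  obtains E where "E \<in> stratum O2" "\<kappa>\<^sub>1 E = x1" "\<kappa>\<^sub>2 E = x2" "\<kappa>\<^sub>3 E = x3" "\<kappa>\<^sub>4 E = x4" "\<kappa>\<^sub>5 E = x5"
proof -
  \<comment> \<open>This inverts the linear system of \<open>kappa_ti_tensor\<close>: once \<open>c5\<close> is known, the systems for
    \<open>(c3, c4)\<close> and then for \<open>(c1, c2)\<close> have determinants 7 and 90.\<close>
  define c5 where "c5 = 35/8 * x5"
  define u v where "u = 3/2 * x3 - c5" and "v = 3/2 * x4 - c5"
  define c3 c4 where "c3 = (5 * u - 4 * v)/7" and "c4 = (3 * v - 2 * u)/7"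
  define s t where "s = x1 - 6*c3 - 4*c4 - c5" and "t = x2 - 2*c3 - 8*c4 - c5"
  define c1 c2 where "c1 = (2 * s - t)/15" and "c2 = (3 * t - s)/30"
  have c34: "3*c3 + 4*c4 = u" "2*c3 + 5*c4 = v" by (simp_all add: c3_def c4_def field_simps)
  have c12: "9*c1 + 6*c2 = s" "3*c1 + 12*c2 = t" by (simp_all add: c1_def c2_def field_simps)
  have n: "norm e3 = 1" by simp
  have nd: "nondegenerate c3 c4 c5"
    using assms by (auto simp: nondegenerate_def c34 u_def v_def c5_def)
  show ?thesis
  proof (rule that)
    show "ti_tensor c1 c2 c3 c4 c5 e3 \<in> stratum O2" unfolding stratum_O2 using n nd by blast
  qed (use c12 c34 in \<open>unfold kappa_ti_tensor[OF n nd], auto simp: s_def t_def u_def v_def c5_def\<close>)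
qed

theorem theorem6p2:
  fixes X :: "tensor4 set" and \<Phi> :: "(tensor4 \<Rightarrow> real) set"
  defines "X \<equiv> stratum O2"
    and "\<Phi> \<equiv> {restrict \<kappa>\<^sub>1 X, restrict \<kappa>\<^sub>2 X, restrict \<kappa>\<^sub>3 X, restrict \<kappa>\<^sub>4 X, restrict \<kappa>\<^sub>5 X}"
  shows "(\<forall>E \<in> X. t_tens E \<in> harmonic2) \<and>
    (\<forall>\<kappa> \<in> \<Phi>. rational_on X \<kappa>) \<and>
    card \<Phi> = 5 \<and>
    minimal_functional_basis SO3 act4 X \<Phi>"
proof (intro conjI)
  show "\<forall>E\<in>X. t_tens E \<in> harmonic2"
    using t_ti_tensor(2) dyad_dev_harmonic unfolding X_def stratum_O2 by auto
  have "rational_on X (restrict f X)" if "rational_on X f" for f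
    using that unfolding rational_on_def by auto
  then show "\<forall>\<kappa>\<in>\<Phi>. rational_on X \<kappa>"
    using rational_kappa unfolding \<Phi>_def X_def by auto
  \<comment> \<open>\<open>P\<close> has all invariants equal to 1, and each \<open>Qi\<close> differs from it in the invariant number \<open>i\<close> only.\<close>
  obtain P where P: "P \<in> X" "\<kappa>\<^sub>1 P = 1" "\<kappa>\<^sub>2 P = 1" "\<kappa>\<^sub>3 P = 1" "\<kappa>\<^sub>4 P = 1" "\<kappa>\<^sub>5 P = 1"
    unfolding X_def by (rule kappa_attains[of 1 1 1 1 1]) auto
  obtain Q1 where Q1: "Q1 \<in> X" "\<kappa>\<^sub>1 Q1 = 2" "\<kappa>\<^sub>2 Q1 = 1" "\<kappa>\<^sub>3 Q1 = 1" "\<kappa>\<^sub>4 Q1 = 1" "\<kappa>\<^sub>5 Q1 = 1"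
    unfolding X_def by (rule kappa_attains[of 1 1 1 2 1]) auto
  obtain Q2 where Q2: "Q2 \<in> X" "\<kappa>\<^sub>1 Q2 = 1" "\<kappa>\<^sub>2 Q2 = 2" "\<kappa>\<^sub>3 Q2 = 1" "\<kappa>\<^sub>4 Q2 = 1" "\<kappa>\<^sub>5 Q2 = 1"
    unfolding X_def by (rule kappa_attains[of 1 1 1 1 2]) auto
  obtain Q3 where Q3: "Q3 \<in> X" "\<kappa>\<^sub>1 Q3 = 1" "\<kappa>\<^sub>2 Q3 = 1" "\<kappa>\<^sub>3 Q3 = 2" "\<kappa>\<^sub>4 Q3 = 1" "\<kappa>\<^sub>5 Q3 = 1"
    unfolding X_def by (rule kappa_attains[of 2 1 1 1 1]) auto
  obtain Q4 where Q4: "Q4 \<in> X" "\<kappa>\<^sub>1 Q4 = 1" "\<kappa>\<^sub>2 Q4 = 1" "\<kappa>\<^sub>3 Q4 = 1" "\<kappa>\<^sub>4 Q4 = 2" "\<kappa>\<^sub>5 Q4 = 1"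
    unfolding X_def by (rule kappa_attains[of 1 2 1 1 1]) auto
  obtain Q5 where Q5: "Q5 \<in> X" "\<kappa>\<^sub>1 Q5 = 1" "\<kappa>\<^sub>2 Q5 = 1" "\<kappa>\<^sub>3 Q5 = 1" "\<kappa>\<^sub>4 Q5 = 1" "\<kappa>\<^sub>5 Q5 = 2"
    unfolding X_def by (rule kappa_attains[of 1 1 2 1 1]) auto
  have value_Q: "restrict \<kappa>\<^sub>1 X Q1 = 2" "restrict \<kappa>\<^sub>2 X Q2 = 2" "restrict \<kappa>\<^sub>3 X Q3 = 2"
      "restrict \<kappa>\<^sub>4 X Q4 = 2" "restrict \<kappa>\<^sub>5 X Q5 = 2"
    using Q1 Q2 Q3 Q4 Q5 by simp_all
  have one: "restrict \<kappa>\<^sub>2 X Q1 = 1" "restrict \<kappa>\<^sub>3 X Q1 = 1" "restrict \<kappa>\<^sub>4 X Q1 = 1" "restrict \<kappa>\<^sub>5 X Q1 = 1"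
      "restrict \<kappa>\<^sub>3 X Q2 = 1" "restrict \<kappa>\<^sub>4 X Q2 = 1" "restrict \<kappa>\<^sub>5 X Q2 = 1"
      "restrict \<kappa>\<^sub>4 X Q3 = 1" "restrict \<kappa>\<^sub>5 X Q3 = 1" "restrict \<kappa>\<^sub>5 X Q4 = 1"
    using Q1 Q2 Q3 Q4 by simp_all
  have "restrict \<kappa>\<^sub>1 X \<notin> {restrict \<kappa>\<^sub>2 X, restrict \<kappa>\<^sub>3 X, restrict \<kappa>\<^sub>4 X, restrict \<kappa>\<^sub>5 X}"
    "restrict \<kappa>\<^sub>2 X \<notin> {restrict \<kappa>\<^sub>3 X, restrict \<kappa>\<^sub>4 X, restrict \<kappa>\<^sub>5 X}"
    "restrict \<kappa>\<^sub>3 X \<notin> {restrict \<kappa>\<^sub>4 X, restrict \<kappa>\<^sub>5 X}" "restrict \<kappa>\<^sub>4 X \<notin> {restrict \<kappa>\<^sub>5 X}"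
    using value_Q one by (metis insertE emptyE numeral_eq_one_iff semiring_norm(85))+
  then show "card \<Phi> = 5" by (simp add: \<Phi>_def)
  show "minimal_functional_basis SO3 act4 X \<Phi>"
  proof (rule minimal_functional_basisI)
    show "functional_basis SO3 act4 X \<Phi>"
    proof (rule functional_basisI)
      show "act4 g E \<in> X" if "g \<in> carrier SO3" "E \<in> X" for g E
        using that kappa_invariant(1) by (simp add: X_def)
      show "finite \<Phi>" "\<Phi> \<subseteq> extensional X" by (auto simp: \<Phi>_def)
      show "invariant_on SO3 act4 X \<phi>" if "\<phi> \<in> \<Phi>" for \<phi>
        using that kappa_invariant by (auto simp: \<Phi>_def X_def invariant_on_def)
      show "\<exists>g\<in>carrier SO3. act4 g E = E'"
        if "E \<in> X" "E' \<in> X" and eq: "\<And>\<phi>. \<phi> \<in> \<Phi> \<Longrightarrow> \<phi> E = \<phi> E'" for E E'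
      proof -
        have "\<kappa> E = \<kappa> E'" if "restrict \<kappa> X \<in> \<Phi>" for \<kappa>
          using eq[OF that] \<open>E \<in> X\<close> \<open>E' \<in> X\<close> by simp
        then have "\<kappa>\<^sub>1 E = \<kappa>\<^sub>1 E'" "\<kappa>\<^sub>2 E = \<kappa>\<^sub>2 E'" "\<kappa>\<^sub>3 E = \<kappa>\<^sub>3 E'" "\<kappa>\<^sub>4 E = \<kappa>\<^sub>4 E'" "\<kappa>\<^sub>5 E = \<kappa>\<^sub>5 E'"
          by (simp_all add: \<Phi>_def)
        then show ?thesis using kappa_separates that(1,2) by (auto simp: X_def)
      qed
    qed
    fix \<phi> assume "\<phi> \<in> \<Phi>"
    then consider "\<phi> = restrict \<kappa>\<^sub>1 X" | "\<phi> = restrict \<kappa>\<^sub>2 X" | "\<phi> = restrict \<kappa>\<^sub>3 X"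
      | "\<phi> = restrict \<kappa>\<^sub>4 X" | "\<phi> = restrict \<kappa>\<^sub>5 X"
      by (auto simp: \<Phi>_def)
    then show "\<exists>x\<in>X. \<exists>y\<in>X. \<phi> x \<noteq> \<phi> y \<and> (\<forall>\<psi>\<in>\<Phi> - {\<phi>}. \<psi> x = \<psi> y)"
    proof cases
      case 1
      then show ?thesis using P Q1 by (intro bexI[of _ P] bexI[of _ Q1]) (auto simp: \<Phi>_def)
    next
      case 2
      then show ?thesis using P Q2 by (intro bexI[of _ P] bexI[of _ Q2]) (auto simp: \<Phi>_def)
    next
      case 3
      then show ?thesis using P Q3 by (intro bexI[of _ P] bexI[of _ Q3]) (auto simp: \<Phi>_def)
    next
      case 4
      then show ?thesis using P Q4 by (intro bexI[of _ P] bexI[of _ Q4]) (auto simp: \<Phi>_def)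
    next
      case 5
      then show ?thesis using P Q5 by (intro bexI[of _ P] bexI[of _ Q5]) (auto simp: \<Phi>_def)
    qed
  qed
qed

end
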